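(* Let $(X_i)_{i\in\mathbb{Z}}$ be a stationary martingale difference sequence in $\mathbb{L}^3$ (in the setting described in the context, with $E_{i-1}(X_i)=0$ a.s. for every $i\in\mathbb{Z}$), such that $\mathbb{E}(X_0^2\mid\mathcal{I})=\mathbb{E}(X_0^2)=\sigma^2$ almost surely, where $\sigma>0$. Let $\Lambda=\sigma^{-2}\mathbb{E}|X_0|^3$ and, for $m\ge 1$, $U_m=E_0(X_1^2+\cdots+X_m^2)-m\sigma^2$. Then: (a) for every integer $n\ge 1$, $$d_1(S_n,\sigma\sqrt{n}\,Y)\le \frac{13\sigma}{6}+\frac{\Lambda}{6}\log(1+2n)+\sum_{m=1}^{[\sqrt{2n}]}\frac{\|X_0U_m\|_1+2\sigma\|U_m\|_1}{m\sigma^2}.$$ (b) If $\sup_{m>0}(\|X_0U_m\|_1+\|U_m\|_1)<\infty$, then $d_1(S_n,\sigma\sqrt{n}\,Y)=O(\log n)$ as $n\to\infty$.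
   Context: Let $(\Omega,\mathcal{A},\mathbb{P})$ be a probability space and $T:\Omega\to\Omega$ a bijective bimeasurable transformation preserving $\mathbb{P}$. $\mathcal{I}$ is the $\sigma$-algebra of invariant sets, i.e. of the $A\in\mathcal{A}$ with $T(A)=A$. $\mathcal{M}_0\subseteq\mathcal{A}$ is a sub-$\sigma$-algebra with $\mathcal{M}_0\subseteq T^{-1}(\mathcal{M}_0)$, and $\mathcal{M}_i=T^{-i}(\mathcal{M}_0)$ for $i\in\mathbb{Z}$ (a nondecreasing filtration). $E_i$ denotes conditional expectation with respect to $\mathcal{M}_i$. $X_0$ is an $\mathcal{M}_0$-measurable centered real random variable and $X_i=X_0\circ T^i$ for $i\in\mathbb{Z}$; $S_n=X_1+\cdots+X_n$. $Y$ is a $\mathcal{N}(0,1)$-distributed random variable. For integrable real random variables $U,V$, $d_1(U,V)=\sup_f \mathbb{E}(f(U)-f(V))$, the supremum being over all 1-Lipschitz functions $f:\mathbb{R}\to\mathbb{R}$. $\|\cdot\|_p$ is the $\mathbb{L}^p(\mathbb{P})$-norm (with value $+\infty$ allowed) and $[x]$ is the integer part of $x$. *)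

theory Defs
  imports "HOL-Probability.Probability"
begin

text \<open>Integer powers of a bijection of \<^term>\<open>space M\<close>; the inverse is taken relative to
  \<^term>\<open>space M\<close>, since \<open>T\<close> need not be injective on the whole type.\<close>

definition int_iter :: "'a measure \<Rightarrow> ('a \<Rightarrow> 'a) \<Rightarrow> int \<Rightarrow> 'a \<Rightarrow> 'a" where
  "int_iter M T i =
     (if 0 \<le> i then T ^^ nat i else the_inv_into (space M) T ^^ nat (- i))"

definition bimeasurable_mpt :: "'a measure \<Rightarrow> ('a \<Rightarrow> 'a) \<Rightarrow> bool" where
  "bimeasurable_mpt M T \<longleftrightarrow>
     bij_betw T (space M) (space M) \<and>
     T \<in> measurable M M \<and>
     the_inv_into (space M) T \<in> measurable M M \<and>
     distr M M T = M"

definition invariant_algebra :: "'a measure \<Rightarrow> ('a \<Rightarrow> 'a) \<Rightarrow> 'a measure" where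
  "invariant_algebra M T = sigma (space M) {A \<in> sets M. T ` A = A}"

text \<open>The \<open>\<sigma>\<close>-algebra \<open>T\<^sup>-\<^sup>i(F)\<close>. Sub-\<open>\<sigma>\<close>-algebras are encoded as
  measures of which only the space and the measurable sets matter.\<close>

definition shifted_algebra ::
    "'a measure \<Rightarrow> ('a \<Rightarrow> 'a) \<Rightarrow> 'a measure \<Rightarrow> int \<Rightarrow> 'a measure" where
  "shifted_algebra M T F i = vimage_algebra (space M) (int_iter M T i) F"

definition shifted_var ::
    "'a measure \<Rightarrow> ('a \<Rightarrow> 'a) \<Rightarrow> ('a \<Rightarrow> real) \<Rightarrow> int \<Rightarrow> 'a \<Rightarrow> real" where
  "shifted_var M T X0 i = X0 \<circ> int_iter M T i"

definition partial_sum ::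
    "'a measure \<Rightarrow> ('a \<Rightarrow> 'a) \<Rightarrow> ('a \<Rightarrow> real) \<Rightarrow> nat \<Rightarrow> 'a \<Rightarrow> real" where
  "partial_sum M T X0 n x = (\<Sum>i=1..n. shifted_var M T X0 (int i) x)"

definition cond_var_dev ::
    "'a measure \<Rightarrow> ('a \<Rightarrow> 'a) \<Rightarrow> 'a measure \<Rightarrow> ('a \<Rightarrow> real) \<Rightarrow> real \<Rightarrow> nat \<Rightarrow> 'a \<Rightarrow> real" where
  "cond_var_dev M T F X0 \<sigma> m x =
     real_cond_exp M F (\<lambda>y. \<Sum>i=1..m. (shifted_var M T X0 (int i) y)\<^sup>2) x - real m * \<sigma>\<^sup>2"

definition L1_norm :: "'a measure \<Rightarrow> ('a \<Rightarrow> real) \<Rightarrow> ennreal" where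
  "L1_norm M f = (\<integral>\<^sup>+ x. ennreal \<bar>f x\<bar> \<partial>M)"

text \<open>The two variables may live on different probability spaces, as only their laws matter.
  The real supremum is a genuine one when both are integrable, see \<open>bdd_above_dist1\<close>.\<close>

definition dist1 :: "'a measure \<Rightarrow> ('a \<Rightarrow> real) \<Rightarrow> 'b measure \<Rightarrow> ('b \<Rightarrow> real) \<Rightarrow> real" where
  "dist1 M U N V =
     (SUP f\<in>{f :: real \<Rightarrow> real. 1-lipschitz_on UNIV f}. (\<integral>x. f (U x) \<partial>M) - (\<integral>x. f (V x) \<partial>N))"

lemma lipschitz_comp_integral:
  fixes U :: "'a \<Rightarrow> real"
  assumes "prob_space M" and U: "integrable M U" and f: "1-lipschitz_on UNIV (f :: real \<Rightarrow> real)"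
  shows "integrable M (\<lambda>x. f (U x))"
    and "\<bar>(\<integral>x. f (U x) \<partial>M) - f 0\<bar> \<le> (\<integral>x. \<bar>U x\<bar> \<partial>M)"
proof -
  interpret prob_space M by fact
  have d: "\<bar>f y - f 0\<bar> \<le> \<bar>y\<bar>" for y
    using lipschitz_onD[OF f, of y 0] by (simp add: dist_real_def)
  have m: "f \<in> borel_measurable borel"
    by (rule borel_measurable_continuous_onI[OF lipschitz_on_continuous_on[OF f]])
  have [measurable]: "(\<lambda>x. f (U x)) \<in> borel_measurable M"
    using measurable_compose[OF borel_measurable_integrable[OF U] m] .
  have i: "integrable M (\<lambda>x. f (U x) - f 0)"
    by (rule Bochner_Integration.integrable_bound[OF U]) (use d in auto)
  then show j: "integrable M (\<lambda>x. f (U x))"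
    using Bochner_Integration.integrable_add[OF i integrable_const[of "f 0"]] by simp
  have "(\<integral>x. f (U x) \<partial>M) - f 0 = (\<integral>x. f (U x) - f 0 \<partial>M)"
    using j by (simp add: prob_space)
  also have "\<bar>\<dots>\<bar> \<le> (\<integral>x. \<bar>f (U x) - f 0\<bar> \<partial>M)"
    by (rule integral_abs_bound)
  also have "\<dots> \<le> (\<integral>x. \<bar>U x\<bar> \<partial>M)"
    by (rule integral_mono) (use i U d in auto)
  finally show "\<bar>(\<integral>x. f (U x) \<partial>M) - f 0\<bar> \<le> (\<integral>x. \<bar>U x\<bar> \<partial>M)" .
qed

lemma bdd_above_dist1:
  fixes U :: "'a \<Rightarrow> real" and V :: "'b \<Rightarrow> real"
  assumes "prob_space M" "integrable M U" "prob_space N" "integrable N V"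
  shows "bdd_above ((\<lambda>f. (\<integral>x. f (U x) \<partial>M) - (\<integral>x. f (V x) \<partial>N)) `
           {f :: real \<Rightarrow> real. 1-lipschitz_on UNIV f})"
proof (rule bdd_aboveI2)
  fix f :: "real \<Rightarrow> real" assume "f \<in> {f. 1-lipschitz_on UNIV f}"
  then have f: "1-lipschitz_on UNIV f" by simp
  show "(\<integral>x. f (U x) \<partial>M) - (\<integral>x. f (V x) \<partial>N) \<le> (\<integral>x. \<bar>U x\<bar> \<partial>M) + (\<integral>x. \<bar>V x\<bar> \<partial>N)"
    using lipschitz_comp_integral(2)[OF assms(1,2) f] lipschitz_comp_integral(2)[OF assms(3,4) f]
    by linarith
qed

end

theory Submission
  imports Defs
begin

text \<open>The proof is Lindeberg's replacement method, with Gaussian smoothing and a summation by parts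
over blocks of growing length.

Fix a 1-Lipschitz function \<open>f\<close> and let \<open>f\<^sub>j\<close> be \<open>f\<close> smoothed by a centred Gaussian of variance \<open>j \<sigma>\<^sup>2\<close>.
Up to an error of order \<open>\<sigma>\<close> the quantity to bound is \<open>E f\<^sub>1(S\<^sub>n) - f\<^sub>n\<^sub>+\<^sub>1(0)\<close>, and it is the sum over
\<open>j = 1..n\<close> of \<open>E f\<^sub>j(S\<^sub>l\<^sub>+\<^sub>1) - E f\<^sub>j\<^sub>+\<^sub>1(S\<^sub>l)\<close> with \<open>l = n - j\<close>: the last remaining summand \<open>X\<^sub>l\<^sub>+\<^sub>1\<close> is exchanged
for a Gaussian of variance \<open>\<sigma>\<^sup>2\<close> (\<open>lindeberg_step\<close>). A Taylor expansion leaves three contributions. The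
first-order term vanishes by the martingale property. The third-order term is at most
\<open>E \<bar>X\<^sub>0\<bar>\<^sup>3 / 6\<close> times the Lipschitz constant of the second derivative of \<open>f\<^sub>j\<close>, which is at most
\<open>1/(j \<sigma>\<^sup>2)\<close>; its sum over \<open>j\<close> gives the factor \<open>\<Lambda>/6 log(1 + 2 n)\<close>. On the Gaussian side the odd moments
vanish, and the fourth-order error of size \<open>\<sigma> j ^ (-3/2)\<close> is summable. All these constants come from the
\<open>L\<^sup>1\<close> norms of Hermite polynomials, since the derivatives of a smoothed function are integrals of the
function against Hermite polynomials (\<open>gauss_deriv\<close>).

What remains is half the sum of the terms \<open>E f\<^sub>j''(S\<^sub>l) (X\<^sub>l\<^sub>+\<^sub>1\<^sup>2 - \<sigma>\<^sup>2)\<close>. A single one of them is not small,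
but sums of consecutive squares have conditional expectations controlled by \<open>U\<^sub>m\<close>. So the indices \<open>j\<close> are cut
into blocks of lengths 1, 2, 3, and so on, and a summation by parts is carried out in each (\<open>block_bound\<close>):
freezing the coefficient gives \<open>\<parallel>U\<^sub>p\<parallel>\<^sub>1\<close> times a bound for \<open>f\<^sub>j''\<close> of order \<open>1/(\<sigma> sqrt j)\<close>, and
the increments of the coefficient give \<open>\<parallel>X\<^sub>0 U\<^sub>r\<parallel>\<^sub>1/(j \<sigma>\<^sup>2)\<close> and \<open>\<parallel>U\<^sub>r\<parallel>\<^sub>1/(j \<sigma>)\<close>. The lengths are
chosen so that the coefficient of each norm adds up to order \<open>1/m\<close> (\<open>triangular_block_sum\<close>), with
about \<open>sqrt(2 n)\<close> blocks, and this is the range of the sum in the claim.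

If the norms are bounded, that sum is a harmonic sum, which yields the rate \<open>log n\<close>.\<close>

section \<open>Hermite polynomials and Gaussian moments\<close>

abbreviation \<gamma> :: "real measure" where
  "\<gamma> \<equiv> std_normal_distribution"

interpretation \<gamma>: real_distribution \<gamma>
  by (rule real_dist_normal_dist)

primrec hermite :: "nat \<Rightarrow> real poly" where
  "hermite 0 = 1"
| "hermite (Suc k) = [:0, 1:] * hermite k - pderiv (hermite k)"

lemma lipschitz_continuous_measurable:
  "L-lipschitz_on UNIV f \<Longrightarrow> (f :: real \<Rightarrow> real) \<in> borel_measurable borel"
  by (intro borel_measurable_continuous_onI lipschitz_on_continuous_on)

lemma poly_borel_measurable [measurable]: "poly (p :: real poly) \<in> borel_measurable borel"
  by (intro borel_measurable_continuous_onI continuous_intros)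

lemma integrable_gauss_poly: "integrable \<gamma> (poly p)"
proof -
  have "integrable \<gamma> (\<lambda>x. \<Sum>i\<le>degree p. coeff p i * x ^ i)"
    by (intro Bochner_Integration.integrable_sum integrable_mult_right
        integrable_std_normal_distribution_moment)
  then show ?thesis
    by (simp add: poly_altdef[abs_def])
qed

lemma integrable_gauss_lipschitz_poly:
  assumes f: "L-lipschitz_on UNIV (f :: real \<Rightarrow> real)"
  shows "integrable \<gamma> (\<lambda>y. f (x + s * y) * poly p y)"
proof (rule Bochner_Integration.integrable_bound)
  show "integrable \<gamma> (\<lambda>y. \<bar>f x\<bar> * \<bar>poly p y\<bar> + L * \<bar>s\<bar> * \<bar>poly ([:0, 1:] * p) y\<bar>)"
    by (intro Bochner_Integration.integrable_add integrable_mult_right integrable_abs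
        integrable_gauss_poly)
  have [measurable]: "f \<in> borel_measurable borel"
    using f by (rule lipschitz_continuous_measurable)
  show "(\<lambda>y. f (x + s * y) * poly p y) \<in> borel_measurable \<gamma>"
    by simp
  have "\<bar>f (x + s * y) * poly p y\<bar>
      \<le> \<bar>f x\<bar> * \<bar>poly p y\<bar> + L * \<bar>s\<bar> * \<bar>poly ([:0, 1:] * p) y\<bar>" for y
  proof -
    have "\<bar>f (x + s * y)\<bar> \<le> \<bar>f x\<bar> + L * \<bar>s * y\<bar>"
      using lipschitz_onD[OF f, of "x + s * y" x] by (simp add: dist_real_def)
    then have "\<bar>f (x + s * y)\<bar> * \<bar>poly p y\<bar> \<le> (\<bar>f x\<bar> + L * \<bar>s * y\<bar>) * \<bar>poly p y\<bar>"
      by (rule mult_right_mono) simp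
    then show ?thesis
      by (simp add: abs_mult algebra_simps)
  qed
  then show "AE y in \<gamma>. norm (f (x + s * y) * poly p y)
      \<le> norm (\<bar>f x\<bar> * \<bar>poly p y\<bar> + L * \<bar>s\<bar> * \<bar>poly ([:0, 1:] * p) y\<bar>)"
    by (intro AE_I2) (smt (verit, best) real_norm_def)
qed

lemma integral_gauss: "f \<in> borel_measurable borel \<Longrightarrow>
  (\<integral>y. f y \<partial>\<gamma>) = (\<integral>y. std_normal_density y * f y \<partial>lborel)" for f :: "real \<Rightarrow> real"
  by (subst integral_density) auto

lemma integrable_gauss: "f \<in> borel_measurable borel \<Longrightarrow>
  integrable \<gamma> f \<longleftrightarrow> integrable lborel (\<lambda>y. std_normal_density y * f y)" for f :: "real \<Rightarrow> real"
  by (subst integrable_density) auto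

definition hermite_L1 :: "nat \<Rightarrow> real" where
  "hermite_L1 k = (\<integral>y. \<bar>poly (hermite k) y\<bar> \<partial>\<gamma>)"

lemma hermite_L1_nonneg: "0 \<le> hermite_L1 k"
  unfolding hermite_L1_def by (intro integral_nonneg_AE) auto

lemma hermite_L1_0: "hermite_L1 0 = 1"
  using \<gamma>.prob_space by (simp add: hermite_L1_def)

lemma sqrt_2_pi_le: "sqrt (2 / pi) \<le> sqrt (2 / 3)"
  using pi_gt3 by (simp add: field_simps)

text \<open>The Lipschitz norms of the Gaussian smoothings below are controlled by the \<open>L\<^sup>1\<close> norms of the Hermite
polynomials of degree 1, 2 and 3 under the Gaussian law. Degree 2 sets the coefficient of the
logarithm, where a bound above 1 would not do; the other two only enter constants with some room,
so that \<open>sqrt (2/3)\<close> can stand for the exact value \<open>sqrt (2/pi)\<close>.\<close>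

lemma hermite_L1_1: "hermite_L1 1 \<le> sqrt (2 / 3)"
  using std_normal_distribution_odd_moments_abs[of 0] sqrt_2_pi_le
  by (simp add: hermite_L1_def pderiv_1)

lemma gauss_moments: "(\<integral>y. y ^ 2 \<partial>\<gamma>) = 1" "(\<integral>y. y ^ 4 \<partial>\<gamma>) = 3" "(\<integral>y. y ^ 6 \<partial>\<gamma>) = 15"
   "(\<integral>y. y \<partial>\<gamma>) = 0" "(\<integral>y. y ^ 3 \<partial>\<gamma>) = 0"
  using std_normal_distribution_even_moments(1)[of 1] std_normal_distribution_even_moments(1)[of 2]
    std_normal_distribution_even_moments(1)[of 3] integral_std_normal_distribution_moment_odd[of 1]
    integral_std_normal_distribution_moment_odd[of 3]
  by (simp_all add: fact_numeral)

lemma hermite_eval: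
  "poly (hermite 1) y = y" "poly (hermite 2) y = y\<^sup>2 - 1" "poly (hermite 3) y = y ^ 3 - 3 * y"
  by (simp_all add: numeral_2_eq_2 numeral_3_eq_3 pderiv_pCons pderiv_1 algebra_simps)

lemma hermite_L1_3: "hermite_L1 3 \<le> 49 / 20"
proof -
  note [simp] = integrable_std_normal_distribution_moment
    integrable_std_normal_distribution_moment[of 1, simplified]
  have "\<bar>y ^ 3 - 3 * y\<bar> \<le> (y ^ 6 - 6 * y ^ 4 + 9 * y\<^sup>2) / 5 + 5 / 4" for y :: real
  proof -
    define z where "z = \<bar>y ^ 3 - 3 * y\<bar>"
    \<comment> \<open>Since \<open>E z\<^sup>2 = 6\<close>, the choice \<open>z \<le> z\<^sup>2/(2a) + a/2\<close> with \<open>a = 5/2\<close> close to \<open>sqrt 6\<close> is almost optimal.\<close>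
    have "0 \<le> (z - 5/2)\<^sup>2" by simp
    moreover have "z\<^sup>2 = y ^ 6 - 6 * y ^ 4 + 9 * y\<^sup>2"
      unfolding z_def by (simp add: power2_eq_square) (simp add: algebra_simps eval_nat_numeral)
    ultimately show ?thesis
      unfolding z_def[symmetric] by (simp add: power2_eq_square algebra_simps add_divide_distrib diff_divide_distrib)
  qed
  then have "hermite_L1 3 \<le> (\<integral>y. (y ^ 6 - 6 * y ^ 4 + 9 * y\<^sup>2) / 5 + 5 / 4 \<partial>\<gamma>)"
    unfolding hermite_L1_def hermite_eval
    by (intro integral_mono) auto
  also have "\<dots> = 49 / 20"
    using \<gamma>.prob_space by (simp add: gauss_moments)
  finally show ?thesis .
qed

lemma std_normal_density_deriv:
  "(std_normal_density has_field_derivative - y * std_normal_density y) (at y)"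
  unfolding std_normal_density_def[abs_def]
  by (auto intro!: derivative_eq_intros simp: field_simps)

text \<open>Cauchy--Schwarz would give \<open>sqrt 2\<close>, which is too large. As \<open>y\<^sup>2 - 1\<close> has mean zero, its absolute
mean is twice the mean of its negative part \<open>(1 - y\<^sup>2)\<close> on \<open>[-1, 1]\<close>; there
\<open>(1 - y\<^sup>2) \<phi>(y)\<close> is the derivative of \<open>y \<phi>(y)\<close>, with \<open>\<phi>\<close> the Gaussian density. The value is
\<open>4 \<phi>(1)\<close>, about 0.97.\<close>

lemma hermite_L1_2: "hermite_L1 2 \<le> 1"
proof -
  let ?I = "indicator {-1..1} :: real \<Rightarrow> real"
  have "(\<integral>y. ?I y *\<^sub>R ((1 - y\<^sup>2) * std_normal_density y) \<partial>lborel)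
      = 1 * std_normal_density 1 - (-1) * std_normal_density (-1)"
  proof (rule integral_FTC_atLeastAtMost)
    show "((\<lambda>y. y * std_normal_density y) has_vector_derivative (1 - y\<^sup>2) * std_normal_density y)
        (at y within {-1..1})" for y
      unfolding has_real_derivative_iff_has_vector_derivative[symmetric]
      by (rule DERIV_subset)
        (auto intro!: derivative_eq_intros std_normal_density_deriv
          simp: algebra_simps power2_eq_square)
    show "continuous_on {-1..1} (\<lambda>y. (1 - y\<^sup>2) * std_normal_density y)"
      unfolding std_normal_density_def by (intro continuous_intros) simp
  qed auto
  then have eq: "(\<integral>y. ?I y * (1 - y\<^sup>2) \<partial>\<gamma>) = 2 * std_normal_density 1"
    by (subst integral_gauss) (auto simp: std_normal_density_def mult_ac)
  note [simp] = integrable_std_normal_distribution_moment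
  have int: "integrable \<gamma> (\<lambda>y. ?I y * (1 - y\<^sup>2))"
    by (rule Bochner_Integration.integrable_bound[of _ "\<lambda>y. 1 + y\<^sup>2"])
      (auto simp: indicator_def abs_le_iff)
  have "\<bar>y\<^sup>2 - 1\<bar> = y\<^sup>2 - 1 + 2 * (?I y * (1 - y\<^sup>2))" for y :: real
  proof -
    have "\<bar>y\<bar> \<le> 1 \<longleftrightarrow> y\<^sup>2 \<le> 1"
      by (simp add: abs_square_le_1)
    then show ?thesis
      by (auto simp: indicator_def)
  qed
  then have "hermite_L1 2 = (\<integral>y. y\<^sup>2 - 1 + 2 * (?I y * (1 - y\<^sup>2)) \<partial>\<gamma>)"
    unfolding hermite_L1_def hermite_eval by presburger
  also have "\<dots> = 4 * std_normal_density 1"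
    using \<gamma>.prob_space int by (simp add: gauss_moments eq)
  also have "\<dots> \<le> 1"
  proof -
    have "1 + 1/2 + (1/2)\<^sup>2 / 2 \<le> exp (1/2 :: real)"
      by (rule exp_lower_Taylor_quadratic) simp
    then have e: "13 / 8 \<le> exp (1/2 :: real)"
      by (simp add: power2_eq_square)
    have "2.464 \<le> sqrt (2 * pi)"
      using pi_approx by (intro real_le_rsqrt) (simp add: power2_eq_square)
    with e have "4 \<le> sqrt (2 * pi) * exp (1/2)"
      using mult_mono[of "2.464" "sqrt (2*pi)" "13/8" "exp (1/2)"] by simp
    then show ?thesis
      by (simp add: std_normal_density_def exp_minus field_simps)
  qed
  finally show ?thesis .
qed

section \<open>Smoothing by a Gaussian\<close>

text \<open>The \<open>k\<close>-th derivative of \<open>x \<mapsto> E f(x + s Y)\<close>, with \<open>Y\<close> standard normal: the derivatives fall on the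
Gaussian kernel and turn into Hermite polynomials, so that \<open>f\<close> itself is never differentiated.\<close>

definition gauss_deriv :: "nat \<Rightarrow> real \<Rightarrow> (real \<Rightarrow> real) \<Rightarrow> real \<Rightarrow> real" where
  "gauss_deriv k s f x = (\<integral>y. f (x + s * y) * poly (hermite k) y \<partial>\<gamma>) / s ^ k"

text \<open>Translating \<open>f\<close> instead of the kernel spends the Lipschitz bound of \<open>f\<close> on one derivative; this is
why only \<open>s ^ k\<close>, and not \<open>s ^ (k + 1)\<close>, appears.\<close>

lemma gauss_deriv_lipschitz:
  assumes f: "1-lipschitz_on UNIV f" and s: "0 < s"
  shows "\<bar>gauss_deriv k s f x - gauss_deriv k s f x'\<bar> \<le> hermite_L1 k / s ^ k * \<bar>x - x'\<bar>"
proof -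
  let ?h = "poly (hermite k)"
  note int = integrable_gauss_lipschitz_poly[OF f]
  have "\<bar>(\<integral>y. f (x + s * y) * ?h y \<partial>\<gamma>) - (\<integral>y. f (x' + s * y) * ?h y \<partial>\<gamma>)\<bar>
      = \<bar>\<integral>y. (f (x + s * y) - f (x' + s * y)) * ?h y \<partial>\<gamma>\<bar>"
    using int by (simp add: left_diff_distrib)
  also have "\<dots> \<le> (\<integral>y. \<bar>(f (x + s * y) - f (x' + s * y)) * ?h y\<bar> \<partial>\<gamma>)"
    by (rule integral_abs_bound)
  also have "\<dots> \<le> (\<integral>y. \<bar>x - x'\<bar> * \<bar>?h y\<bar> \<partial>\<gamma>)"
  proof (rule integral_mono)
    show "integrable \<gamma> (\<lambda>y. \<bar>(f (x + s * y) - f (x' + s * y)) * ?h y\<bar>)"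
      using int by (intro integrable_abs) (simp add: left_diff_distrib)
    show "integrable \<gamma> (\<lambda>y. \<bar>x - x'\<bar> * \<bar>?h y\<bar>)"
      by (intro integrable_mult_right integrable_abs integrable_gauss_poly)
    show "\<bar>(f (x + s * y) - f (x' + s * y)) * ?h y\<bar> \<le> \<bar>x - x'\<bar> * \<bar>?h y\<bar>" for y
      using lipschitz_onD[OF f, of "x + s * y" "x' + s * y"]
      by (auto simp: abs_mult dist_real_def intro!: mult_right_mono)
  qed
  also have "\<dots> = \<bar>x - x'\<bar> * hermite_L1 k"
    by (simp add: hermite_L1_def)
  finally show ?thesis
    using s by (simp add: gauss_deriv_def diff_divide_distrib[symmetric] field_simps)
qed

lemma gauss_deriv_measurable:
  assumes f: "1-lipschitz_on UNIV f" and s: "0 < s"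
  shows "gauss_deriv k s f \<in> borel_measurable borel"
proof -
  have "(hermite_L1 k / s ^ k)-lipschitz_on UNIV (gauss_deriv k s f)"
    using gauss_deriv_lipschitz[OF f s] hermite_L1_nonneg s
    by (auto intro!: lipschitz_onI simp: dist_real_def)
  then show ?thesis
    by (rule lipschitz_continuous_measurable)
qed

lemma DERIV_from_quadratic_error:
  fixes g :: "real \<Rightarrow> real"
  assumes "\<And>h. \<bar>h\<bar> \<le> 1 \<Longrightarrow> \<bar>g (x + h) - g x - h * d\<bar> \<le> K * h\<^sup>2"
  shows "(g has_field_derivative d) (at x)"
proof -
  have "((\<lambda>h. (g (x + h) - g x) / h - d) \<longlongrightarrow> 0) (at 0)"
  proof (rule Lim_null_comparison)
    show "((\<lambda>h. K * \<bar>h\<bar>) \<longlongrightarrow> 0) (at 0)"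
      by (auto intro!: tendsto_eq_intros)
    have "\<forall>\<^sub>F h in at (0::real). h \<noteq> 0 \<and> \<bar>h\<bar> \<le> 1"
      unfolding eventually_at by (intro exI[of _ 1]) auto
    then show "\<forall>\<^sub>F h in at 0. norm ((g (x + h) - g x) / h - d) \<le> K * \<bar>h\<bar>"
    proof eventually_elim
      case (elim h)
      then have "norm ((g (x + h) - g x) / h - d) = \<bar>g (x + h) - g x - h * d\<bar> / \<bar>h\<bar>"
        by (simp add: field_simps flip: abs_divide)
      also have "\<dots> \<le> K * h\<^sup>2 / \<bar>h\<bar>"
        using elim assms by (intro divide_right_mono) auto
      also have "\<dots> = K * \<bar>h\<bar>"
        using elim by (auto simp: power2_eq_square abs_if)
      finally show ?case .
    qed
  qed
  then show ?thesis
    unfolding DERIV_def by (simp add: Lim_null[symmetric])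
qed

lemma poly_gauss_bound:
  "\<exists>C\<ge>0. \<forall>v. \<bar>poly p v * std_normal_density v\<bar> \<le> C * exp (- v\<^sup>2 / 4)"
proof -
  have pow: "\<bar>v\<bar> ^ i \<le> fact i * exp 1 * exp (v\<^sup>2 / 4)" for v :: real and i
  proof -
    have "\<bar>v\<bar> ^ i / fact i \<le> exp \<bar>v\<bar>"
      using sum_le_suminf[OF summable_exp_generic[of "\<bar>v\<bar>"], of "{i}"]
      by (simp add: exp_def divide_inverse mult_ac)
    also have "\<bar>v\<bar> \<le> 1 + v\<^sup>2 / 4"
      using zero_le_power2[of "\<bar>v\<bar> / 2 - 1"] by (simp add: power2_eq_square field_simps)
    then have "exp \<bar>v\<bar> \<le> exp 1 * exp (v\<^sup>2 / 4)"
      by (simp flip: exp_add)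
    finally show ?thesis
      by (simp add: field_simps)
  qed
  define C where "C = (\<Sum>i\<le>degree p. \<bar>coeff p i\<bar> * (fact i * exp 1))"
  have "\<bar>poly p v * std_normal_density v\<bar> \<le> C * exp (- v\<^sup>2 / 4)" for v
  proof -
    have "\<bar>poly p v\<bar> \<le> (\<Sum>i\<le>degree p. \<bar>coeff p i\<bar> * \<bar>v\<bar> ^ i)"
      unfolding poly_altdef by (rule order_trans[OF sum_abs]) (simp add: abs_mult power_abs)
    also have "\<dots> \<le> (\<Sum>i\<le>degree p. \<bar>coeff p i\<bar> * (fact i * exp 1 * exp (v\<^sup>2 / 4)))"
      by (intro sum_mono mult_left_mono pow) auto
    also have "\<dots> = C * exp (v\<^sup>2 / 4)"
      unfolding C_def sum_distrib_right by (simp add: mult.assoc)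
    finally have 1: "\<bar>poly p v\<bar> \<le> C * exp (v\<^sup>2 / 4)" .
    have "1 \<le> sqrt (2 * pi)"
      using pi_gt3 by simp
    then have "std_normal_density v \<le> exp (- v\<^sup>2 / 2)"
      by (simp add: std_normal_density_def field_simps)
    with 1 have "\<bar>poly p v\<bar> * std_normal_density v \<le> C * exp (v\<^sup>2 / 4) * exp (- v\<^sup>2 / 2)"
      by (intro mult_mono) auto
    also have "\<dots> = C * exp (- v\<^sup>2 / 4)"
      by (simp flip: exp_add add: mult.assoc)
    finally show ?thesis
      by (simp add: abs_mult)
  qed
  moreover have "0 \<le> C"
    unfolding C_def by (intro sum_nonneg) auto
  ultimately show ?thesis by blast
qed

text \<open>Rodrigues' formula, in differential form.\<close>

lemma hermite_density_deriv:
  "((\<lambda>y. poly (hermite k) y * std_normal_density y) has_field_derivative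
      - (poly (hermite (Suc k)) y * std_normal_density y)) (at y)"
  by (auto intro!: derivative_eq_intros std_normal_density_deriv simp: algebra_simps)

text \<open>The domination needed to differentiate under the integral: the second-order error of shifting a
Hermite kernel is at most a multiple of \<open>h\<^sup>2\<close> times a wider Gaussian. The loss from
\<open>exp (- v\<^sup>2/4)\<close> to \<open>exp (- v\<^sup>2/8)\<close> pays for evaluating at a point within distance 1 of \<open>v\<close>.\<close>

lemma hermite_kernel_taylor:
  "\<exists>C\<ge>0. \<forall>v h. \<bar>h\<bar> \<le> 1 \<longrightarrow>
     \<bar>poly (hermite k) (v - h) * std_normal_density (v - h)
        - poly (hermite k) v * std_normal_density v
        - h * (poly (hermite (Suc k)) v * std_normal_density v)\<bar>
      \<le> C * h\<^sup>2 * exp (- v\<^sup>2 / 8)"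
proof -
  let ?p = "\<lambda>k v. poly (hermite k) v * std_normal_density v"
  obtain C where C: "0 \<le> C" "\<And>v. \<bar>?p (Suc (Suc k)) v\<bar> \<le> C * exp (- v\<^sup>2 / 4)"
    using poly_gauss_bound by blast
  have "\<bar>?p k (v - h) - ?p k v - h * ?p (Suc k) v\<bar> \<le> (C * exp (1/4)) * h\<^sup>2 * exp (- v\<^sup>2 / 8)"
    if h: "\<bar>h\<bar> \<le> 1" for v h
  proof -
    have "\<exists>t. \<bar>t\<bar> \<le> \<bar>h\<bar> \<and> ?p k (v - h)
        = (\<Sum>m<2. (?p (k + m) (v - 0) / fact m) * h ^ m) + (?p (k + 2) (v - t) / fact 2) * h ^ 2"
    proof (rule Maclaurin_all_le[of "\<lambda>m t. ?p (k + m) (v - t)" "\<lambda>t. ?p k (v - t)"])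
      show "\<forall>m t. ((\<lambda>t. ?p (k + m) (v - t)) has_real_derivative ?p (k + Suc m) (v - t)) (at t)"
      proof (intro allI)
        fix m t
        have "((\<lambda>t. ?p (k + m) (v - t)) has_real_derivative
            - ?p (Suc (k + m)) (v - t) * (0 - 1)) (at t)"
          by (rule DERIV_chain'[where g = "?p (k + m)" and f = "\<lambda>t. v - t"])
            (auto intro!: derivative_eq_intros hermite_density_deriv simp del: hermite.simps)
        then show "((\<lambda>t. ?p (k + m) (v - t)) has_real_derivative ?p (k + Suc m) (v - t)) (at t)"
          by simp
      qed
    qed simp
    then obtain t where t: "\<bar>t\<bar> \<le> \<bar>h\<bar>" and
      eq: "?p k (v - h) = ?p k v + ?p (Suc k) v * h + ?p (Suc (Suc k)) (v - t) / 2 * h\<^sup>2"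
      by (auto simp: lessThan_Suc numeral_2_eq_2 simp del: hermite.simps)
    have "\<bar>?p k (v - h) - ?p k v - h * ?p (Suc k) v\<bar> = \<bar>?p (Suc (Suc k)) (v - t)\<bar> / 2 * h\<^sup>2"
      unfolding eq by (simp add: abs_mult mult.commute del: hermite.simps)
    also have "\<dots> \<le> \<bar>?p (Suc (Suc k)) (v - t)\<bar> * h\<^sup>2"
      by (intro mult_right_mono) auto
    also have "\<dots> \<le> C * exp (- (v - t)\<^sup>2 / 4) * h\<^sup>2"
      by (intro mult_right_mono C) auto
    also have "\<dots> \<le> C * exp (1 / 4 + - v\<^sup>2 / 8) * h\<^sup>2"
    proof (intro mult_right_mono mult_left_mono C)
      have "v\<^sup>2 \<le> 2 * (v - t)\<^sup>2 + 2 * t\<^sup>2"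
        using zero_le_power2[of "v - 2 * t"] by (simp add: power2_eq_square algebra_simps)
      moreover have "t\<^sup>2 \<le> 1"
        using t h by (simp add: abs_square_le_1)
      ultimately show "exp (- (v - t)\<^sup>2 / 4) \<le> exp (1 / 4 + - v\<^sup>2 / 8)"
        by simp
    qed simp
    finally show ?thesis
      unfolding exp_add by (simp only: mult_ac)
  qed
  moreover have "0 \<le> C * exp (1/4)"
    using C by simp
  ultimately show ?thesis by blast
qed

lemma has_deriv_gauss_deriv:
  assumes f: "1-lipschitz_on UNIV f" and s: "0 < s"
  shows "(gauss_deriv k s f has_field_derivative gauss_deriv (Suc k) s f x) (at x)"
proof -
  let ?p = "\<lambda>k v. poly (hermite k) v * std_normal_density v"
  have [measurable]: "f \<in> borel_measurable borel"
    using f by (rule lipschitz_continuous_measurable)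
  \<comment> \<open>Rescaling by \<open>s\<close> makes the kernel independent of \<open>s\<close>.\<close>
  define H where "H k z = (\<integral>y. f (s * z + s * y) * poly (hermite k) y \<partial>\<gamma>)" for k z
  have H_eq: "H k z = (\<integral>y. f (s * (z + y)) * ?p k y \<partial>lborel)" for k z
    unfolding H_def by (subst integral_gauss) (simp_all add: algebra_simps)
  have H_int: "integrable lborel (\<lambda>y. f (s * (z + y)) * ?p k y)" for k z
    using integrable_gauss_lipschitz_poly[OF f, of "s * z" s "hermite k"]
    by (subst (asm) integrable_gauss) (simp_all add: algebra_simps)
  have H_deriv: "(H k has_field_derivative H (Suc k) z) (at z)" for z
  proof -
    obtain C where C: "0 \<le> C" "\<And>v h. \<bar>h\<bar> \<le> 1 \<Longrightarrow>
        \<bar>?p k (v - h) - ?p k v - h * ?p (Suc k) v\<bar> \<le> C * h\<^sup>2 * exp (- v\<^sup>2 / 8)"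
      using hermite_kernel_taylor[of k] by blast
    define D where "D v = (\<bar>f (s * z)\<bar> + s * \<bar>v\<bar>) * exp (- v\<^sup>2 / 8)" for v
    have D_int: "integrable lborel D"
    proof -
      have "integrable lborel (\<lambda>v. (\<bar>f (s * z)\<bar> * sqrt (8 * pi)) * normal_density 0 2 v
          + (s * sqrt (8 * pi)) * (normal_density 0 2 v * \<bar>v - 0\<bar> ^ 1))"
        by (intro Bochner_Integration.integrable_add integrable_mult_right
            integrable_normal_moment_abs integrable_normal_density) auto
      also have "(\<lambda>v. (\<bar>f (s * z)\<bar> * sqrt (8 * pi)) * normal_density 0 2 v
          + (s * sqrt (8 * pi)) * (normal_density 0 2 v * \<bar>v - 0\<bar> ^ 1)) = D"
        by (simp add: D_def normal_density_def fun_eq_iff field_simps)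
      finally show ?thesis .
    qed
    have "\<bar>H k (z + h) - H k z - h * H (Suc k) z\<bar> \<le> (C * (\<integral>v. D v \<partial>lborel)) * h\<^sup>2"
      if h: "\<bar>h\<bar> \<le> 1" for h
    proof -
      let ?e = "\<lambda>v. ?p k (v - h) - ?p k v - h * ?p (Suc k) v"
      have shift: "H k (z + h) = (\<integral>v. f (s * (z + v)) * ?p k (v - h) \<partial>lborel)"
        unfolding H_eq
        by (subst lborel_integral_real_affine[of 1 _ "-h"]) (simp_all add: algebra_simps)
      have shift_int: "integrable lborel (\<lambda>v. f (s * (z + v)) * ?p k (v - h))"
        using lborel_integrable_real_affine[OF H_int[of "z + h" k], of 1 "-h"]
        by (simp add: algebra_simps)
      have int_mult: "integrable lborel (\<lambda>v. h * (f (s * (z + v)) * ?p (Suc k) v))"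
        by (intro integrable_mult_right H_int)
      have eq: "H k (z + h) - H k z - h * H (Suc k) z = (\<integral>v. f (s * (z + v)) * ?e v \<partial>lborel)"
        unfolding shift H_eq[of k z] H_eq[of "Suc k" z]
        using shift_int H_int[of z k] int_mult
        by (simp add: right_diff_distrib mult.left_commute[of _ h] del: hermite.simps)
      have int: "integrable lborel (\<lambda>v. f (s * (z + v)) * ?e v)"
        using shift_int H_int[of z k] int_mult
        by (simp add: right_diff_distrib mult.left_commute[of _ h] del: hermite.simps)
      have "\<bar>\<integral>v. f (s * (z + v)) * ?e v \<partial>lborel\<bar> \<le> (\<integral>v. \<bar>f (s * (z + v)) * ?e v\<bar> \<partial>lborel)"
        by (rule integral_abs_bound)
      also have "\<dots> \<le> (\<integral>v. C * h\<^sup>2 * D v \<partial>lborel)"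
      proof (rule integral_mono)
        fix v
        have "\<bar>f (s * (z + v))\<bar> \<le> \<bar>f (s * z)\<bar> + s * \<bar>v\<bar>"
          using lipschitz_onD[OF f, of "s * (z + v)" "s * z"] s
          by (simp add: dist_real_def algebra_simps abs_mult)
        then have "\<bar>f (s * (z + v))\<bar> * \<bar>?e v\<bar>
            \<le> (\<bar>f (s * z)\<bar> + s * \<bar>v\<bar>) * (C * h\<^sup>2 * exp (- v\<^sup>2 / 8))"
          using C(2)[OF h] s by (intro mult_mono) auto
        then show "\<bar>f (s * (z + v)) * ?e v\<bar> \<le> C * h\<^sup>2 * D v"
          by (simp add: D_def abs_mult mult_ac del: hermite.simps)
      qed (use int D_int in auto)
      finally show ?thesis
        unfolding eq by (simp add: mult_ac del: hermite.simps)
    qed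
    then show ?thesis
      by (rule DERIV_from_quadratic_error)
  qed
  have eq: "gauss_deriv k s f = (\<lambda>x. H k (x / s) / s ^ k)" for k
    using s by (simp add: gauss_deriv_def H_def fun_eq_iff)
  have "((\<lambda>x. H k (x / s) / s ^ k) has_field_derivative (H (Suc k) (x / s) * (1 / s)) / s ^ k) (at x)"
    by (intro DERIV_cdivide DERIV_chain'[OF _ H_deriv]) (use s in \<open>auto intro!: derivative_eq_intros\<close>)
  then show ?thesis
    unfolding eq by (simp add: mult_ac)
qed

text \<open>A Lipschitz constant bounds the derivative.\<close>

lemma gauss_deriv_Suc_bound:
  assumes f: "1-lipschitz_on UNIV f" and s: "0 < s"
  shows "\<bar>gauss_deriv (Suc k) s f x\<bar> \<le> hermite_L1 k / s ^ k"
proof (rule tendsto_upperbound)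
  show "((\<lambda>h. \<bar>(gauss_deriv k s f (x + h) - gauss_deriv k s f x) / h\<bar>)
      \<longlongrightarrow> \<bar>gauss_deriv (Suc k) s f x\<bar>) (at 0)"
    using has_deriv_gauss_deriv[OF f s, of k x] unfolding DERIV_def by (rule tendsto_rabs)
  have "\<forall>\<^sub>F h in at (0::real). h \<noteq> 0"
    by (simp add: eventually_at_filter)
  then show "\<forall>\<^sub>F h in at 0. \<bar>(gauss_deriv k s f (x + h) - gauss_deriv k s f x) / h\<bar>
      \<le> hermite_L1 k / s ^ k"
  proof eventually_elim
    case (elim h)
    then show ?case
      using gauss_deriv_lipschitz[OF f s, of k "x + h" x] by (simp add: abs_divide pos_divide_le_eq)
  qed
qed simp

lemma gauss_deriv_taylor:
  assumes f: "1-lipschitz_on UNIV f" and s: "0 < s"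
  shows "\<bar>gauss_deriv k s f (x + h)
      - (\<Sum>m\<le>n. gauss_deriv (k + m) s f x * h ^ m / fact m)\<bar>
    \<le> hermite_L1 (k + n) / s ^ (k + n) * \<bar>h\<bar> ^ Suc n / fact (Suc n)"
proof -
  have "\<exists>t. \<bar>t\<bar> \<le> \<bar>h\<bar> \<and> gauss_deriv k s f (x + h)
      = (\<Sum>m<Suc n. (gauss_deriv (k + m) s f (x + 0) / fact m) * h ^ m)
        + (gauss_deriv (k + Suc n) s f (x + t) / fact (Suc n)) * h ^ Suc n"
  proof (rule Maclaurin_all_le[of "\<lambda>m t. gauss_deriv (k + m) s f (x + t)"])
    show "\<forall>m t. ((\<lambda>t. gauss_deriv (k + m) s f (x + t)) has_real_derivative
        gauss_deriv (k + Suc m) s f (x + t)) (at t)"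
      using has_deriv_gauss_deriv[OF f s]
      by (auto simp: DERIV_shift[of "gauss_deriv _ s f", symmetric] add.commute)
  qed simp
  then obtain t where "gauss_deriv k s f (x + h)
      = (\<Sum>m<Suc n. (gauss_deriv (k + m) s f (x + 0) / fact m) * h ^ m)
        + (gauss_deriv (k + Suc n) s f (x + t) / fact (Suc n)) * h ^ Suc n"
    by blast
  then have t: "gauss_deriv k s f (x + h)
      - (\<Sum>m<Suc n. gauss_deriv (k + m) s f x * h ^ m / fact m)
      = gauss_deriv (Suc (k + n)) s f (x + t) * h ^ Suc n / fact (Suc n)"
    by (simp del: fact_Suc power_Suc)
  have "\<bar>gauss_deriv (Suc (k + n)) s f (x + t) * h ^ Suc n / fact (Suc n)\<bar>
      = \<bar>gauss_deriv (Suc (k + n)) s f (x + t)\<bar> * \<bar>h\<bar> ^ Suc n / fact (Suc n)"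
    by (simp add: abs_mult power_abs del: fact_Suc power_Suc)
  also have "\<dots> \<le> hermite_L1 (k + n) / s ^ (k + n) * \<bar>h\<bar> ^ Suc n / fact (Suc n)"
    by (intro divide_right_mono mult_right_mono gauss_deriv_Suc_bound f s) auto
  finally show ?thesis
    unfolding lessThan_Suc_atMost[symmetric] t .
qed

section \<open>The semigroup property\<close>

text \<open>The sum of two independent centred Gaussian variables is Gaussian: the convolution formula for the
densities, read as an identity of expectations.\<close>

lemma gauss_semigroup:
  assumes a: "0 < a" and b: "0 < b" and g: "L-lipschitz_on UNIV (g :: real \<Rightarrow> real)"
  shows "(\<integral>y. (\<integral>z. g (a * y + b * z) \<partial>\<gamma>) \<partial>\<gamma>) = (\<integral>y. g (sqrt (a\<^sup>2 + b\<^sup>2) * y) \<partial>\<gamma>)"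
proof -
  have [measurable]: "g \<in> borel_measurable borel"
    using g by (rule lipschitz_continuous_measurable)
  have scale: "distr \<gamma> lborel (\<lambda>y. c * y) = density lborel (normal_density 0 c)" if "0 < c" for c
  proof -
    have "distributed \<gamma> lborel (\<lambda>x. x) std_normal_density"
      by (auto simp: distributed_def intro!: measure_eqI simp: distr_id2)
    from \<gamma>.normal_density_affine[OF this, of c 0] that
    have "distributed \<gamma> lborel (\<lambda>y. c * y) (normal_density 0 c)"
      by simp
    then show ?thesis
      by (rule distributed_distr_eq_density)
  qed
  have fin: "finite_measure (density lborel (normal_density 0 c))" if "0 < c" for c
    using prob_space_normal_density[OF that] by (rule prob_space.axioms(1))
  have c: "0 < sqrt (a\<^sup>2 + b\<^sup>2)"
    using a b by (simp add: add_pos_pos)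
  let ?N = "\<lambda>c. density lborel (normal_density 0 c)"
  have conv: "?N a \<star> ?N b = ?N (sqrt (a\<^sup>2 + b\<^sup>2))"
    using conv_normal_density_zero_mean[OF a b]
    by (subst convolution_density) (auto simp: fin a b ennreal_mult)
  interpret A: prob_space "?N a" by (rule prob_space_normal_density[OF a])
  interpret B: prob_space "?N b" by (rule prob_space_normal_density[OF b])
  interpret AB: pair_prob_space "?N a" "?N b" ..
  have sc: "(\<integral>y. h (c * y) \<partial>\<gamma>) = (\<integral>y. h y \<partial>?N c)"
    if "0 < c" "h \<in> borel_measurable borel" for c and h :: "real \<Rightarrow> real"
    unfolding scale[OF that(1), symmetric] using that by (subst integral_distr) auto
  have int: "integrable (?N a \<star> ?N b) g"
    unfolding conv scale[OF c, symmetric]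
    using integrable_gauss_lipschitz_poly[OF g, of 0 "sqrt (a\<^sup>2 + b\<^sup>2)" 1]
    by (subst integrable_distr_eq) auto
  have "(\<integral>y. g (sqrt (a\<^sup>2 + b\<^sup>2) * y) \<partial>\<gamma>) = (\<integral>y. g y \<partial>(?N a \<star> ?N b))"
    unfolding conv by (rule sc[OF c]) simp
  also have "\<dots> = (\<integral>p. g (fst p + snd p) \<partial>(?N a \<Otimes>\<^sub>M ?N b))"
    unfolding convolution_def by (subst integral_distr) (auto simp: case_prod_beta)
  also have "\<dots> = (\<integral>y. (\<integral>z. g (y + z) \<partial>?N b) \<partial>?N a)"
  proof -
    have "integrable (?N a \<Otimes>\<^sub>M ?N b) (\<lambda>p. g (fst p + snd p))"
      using int unfolding convolution_def
      by (subst (asm) integrable_distr_eq) (auto simp: case_prod_beta)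
    from AB.integral_fst'[OF this] show ?thesis
      by simp
  qed
  also have "\<dots> = (\<integral>y. (\<integral>z. g (a * y + z) \<partial>?N b) \<partial>\<gamma>)"
    by (rule sc[OF a, symmetric]) measurable
  also have "\<dots> = (\<integral>y. (\<integral>z. g (a * y + b * z) \<partial>\<gamma>) \<partial>\<gamma>)"
    by (intro Bochner_Integration.integral_cong refl sc[OF b, symmetric]) measurable
  finally show ?thesis ..
qed

lemma gauss_deriv_integrable:
  assumes f: "1-lipschitz_on UNIV f" and s: "0 < s"
  shows "integrable \<gamma> (\<lambda>y. gauss_deriv k s f (x + t * y))"
proof -
  have "(hermite_L1 k / s ^ k)-lipschitz_on UNIV (gauss_deriv k s f)"
    using gauss_deriv_lipschitz[OF f s] hermite_L1_nonneg s
    by (auto intro!: lipschitz_onI simp: dist_real_def)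
  from integrable_gauss_lipschitz_poly[OF this, of x t 1] show ?thesis
    by simp
qed

text \<open>Smoothing commutes with differentiation. The derivative of the left-hand side is computed directly
from the Taylor bound, and derivatives are unique.\<close>

lemma gauss_deriv_semigroup:
  assumes f: "1-lipschitz_on UNIV f" and s: "0 < s" and t: "0 < t"
  shows "(\<integral>y. gauss_deriv k s f (x + t * y) \<partial>\<gamma>) = gauss_deriv k (sqrt (t\<^sup>2 + s\<^sup>2)) f x"
proof (induction k arbitrary: x)
  case 0
  have "1-lipschitz_on UNIV (\<lambda>u. f (x + u))"
    using lipschitz_onD[OF f, of "x + _" "x + _"] by (intro lipschitz_onI) (auto simp: dist_real_def)
  from gauss_semigroup[OF t s this] show ?case
    by (simp add: gauss_deriv_def add.assoc)
next
  case (Suc k)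
  let ?r = "sqrt (t\<^sup>2 + s\<^sup>2)"
  have r: "0 < ?r"
    using s t by (simp add: add_pos_pos)
  have "((\<lambda>x. \<integral>y. gauss_deriv k s f (x + t * y) \<partial>\<gamma>) has_field_derivative
      (\<integral>y. gauss_deriv (Suc k) s f (x + t * y) \<partial>\<gamma>)) (at x)"
  proof (rule DERIV_from_quadratic_error)
    fix h :: real
    let ?K = "hermite_L1 (Suc k) / s ^ Suc k"
    let ?e = "\<lambda>y. gauss_deriv k s f (x + h + t * y) - gauss_deriv k s f (x + t * y)
          - h * gauss_deriv (Suc k) s f (x + t * y)"
    note int = gauss_deriv_integrable[OF f s, of _ _ t]
    have "\<bar>(\<integral>y. gauss_deriv k s f (x + h + t * y) \<partial>\<gamma>) - (\<integral>y. gauss_deriv k s f (x + t * y) \<partial>\<gamma>)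
          - h * (\<integral>y. gauss_deriv (Suc k) s f (x + t * y) \<partial>\<gamma>)\<bar> = \<bar>\<integral>y. ?e y \<partial>\<gamma>\<bar>"
      using int by simp
    also have "\<dots> \<le> (\<integral>y. \<bar>?e y\<bar> \<partial>\<gamma>)"
      by (rule integral_abs_bound)
    also have "\<dots> \<le> (\<integral>y. ?K * h\<^sup>2 \<partial>\<gamma>)"
    proof (rule integral_mono)
      fix y
      have "\<bar>h\<bar> ^ Suc (Suc 0) = h\<^sup>2"
        by (simp add: power2_eq_square)
      with gauss_deriv_taylor[OF f s, of k "x + t * y" h 1]
      have "\<bar>?e y\<bar> \<le> ?K * h\<^sup>2 / 2"
        by (simp add: algebra_simps del: power_Suc)
      also have "\<dots> \<le> ?K * h\<^sup>2"
        using hermite_L1_nonneg[of "Suc k"] s by (simp add: field_simps)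
      finally show "\<bar>?e y\<bar> \<le> ?K * h\<^sup>2" .
    qed (use int in auto)
    also have "\<dots> = ?K * h\<^sup>2"
      using \<gamma>.prob_space by simp
    finally show "\<bar>(\<integral>y. gauss_deriv k s f (x + h + t * y) \<partial>\<gamma>)
        - (\<integral>y. gauss_deriv k s f (x + t * y) \<partial>\<gamma>)
        - h * (\<integral>y. gauss_deriv (Suc k) s f (x + t * y) \<partial>\<gamma>)\<bar> \<le> ?K * h\<^sup>2" .
  qed
  then have "(gauss_deriv k ?r f has_field_derivative
      (\<integral>y. gauss_deriv (Suc k) s f (x + t * y) \<partial>\<gamma>)) (at x)"
    by (simp add: Suc.IH)
  then show ?case
    using has_deriv_gauss_deriv[OF f r] by (rule DERIV_unique)
qed

section \<open>Numerical series and triangular blocks\<close>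

text \<open>By convexity \<open>1/j\<close> is at most the integral of \<open>1/x\<close> over \<open>[j - 1/2, j + 1/2]\<close>, which is
\<open>ln ((1 + x) / (1 - x))\<close> with \<open>x = 1/(2 j)\<close>.\<close>

lemma harmonic_sum_le_ln: "(\<Sum>j=1..n. 1 / real j) \<le> ln (1 + 2 * real n)"
proof (induction n)
  case (Suc n)
  define x where "x = 1 / (2 * real n + 2)"
  have x: "0 \<le> x" "x < 1"
    by (simp_all add: x_def)
  have "0 \<le> ln (1 + x) - ln (1 - x) - 2 * x"
  proof -
    define g where "g x = ln (1 + x) - ln (1 - x) - 2 * x" for x :: real
    have "g 0 \<le> g x"
    proof (rule DERIV_nonneg_imp_nondecreasing[OF x(1)])
      fix y assume "0 \<le> y" "y \<le> x"
      then have y: "0 \<le> y" "y < 1" using x by auto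
      then have "(g has_field_derivative 1 / (1 + y) + 1 / (1 - y) - 2) (at y)"
        unfolding g_def by (auto intro!: derivative_eq_intros)
      moreover have "0 \<le> 1 / (1 + y) + 1 / (1 - y) - 2"
      proof -
        have "(1 + y) * (1 - y) \<le> 1"
          by (simp add: algebra_simps)
        then have "2 / 1 \<le> 2 / ((1 + y) * (1 - y))"
          using y by (intro divide_left_mono) auto
        also have "\<dots> = 1 / (1 + y) + 1 / (1 - y)"
          using y by (simp add: add_frac_eq)
        finally show ?thesis by simp
      qed
      ultimately show "\<exists>z. (g has_real_derivative z) (at y) \<and> 0 \<le> z"
        by blast
    qed
    then have "0 \<le> g x" by (simp add: g_def)
    then show ?thesis by (simp add: g_def)
  qed
  moreover have "ln ((1 + x) / (1 - x)) = ln (1 + x) - ln (1 - x)"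
    using x by (intro ln_divide_pos) auto
  moreover have "1 / real (Suc n) = 2 * x"
    by (simp add: x_def divide_simps)
  ultimately have "1 / real (Suc n) \<le> ln ((1 + x) / (1 - x))"
    by linarith
  also have "(1 + x) / (1 - x) = (1 + 2 * real (Suc n)) / (1 + 2 * real n)"
    by (simp add: x_def divide_simps)
  also have "ln \<dots> = ln (1 + 2 * real (Suc n)) - ln (1 + 2 * real n)"
    by (rule ln_divide_pos) auto
  finally show ?case
    using Suc by simp
qed simp

lemma sum_inverse_three_halves: "1 \<le> n \<Longrightarrow> (\<Sum>j=1..n. 1 / (real j * sqrt (real j))) \<le> 3 - 2 / sqrt (real n)"
proof (induction n rule: nat_induct_at_least)
  case (Suc n)
  define a b where "a = sqrt (real n)" and "b = sqrt (real (Suc n))"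
  have ab: "0 < a" "a \<le> b" "b\<^sup>2 = a\<^sup>2 + 1" "real (Suc n) = b\<^sup>2"
    using Suc.hyps by (simp_all add: a_def b_def)
  have "b - a = 1 / (a + b)"
    using ab by (simp add: field_simps power2_eq_square)
  also have "1 / (2 * b) \<le> 1 / (a + b)"
    using ab by (intro divide_left_mono) auto
  finally have "1 / (2 * b) \<le> b - a" .
  then have "2 / (a * b) * (1 / (2 * b)) \<le> 2 / (a * b) * (b - a)"
    using ab by (intro mult_left_mono) auto
  moreover have "2 / (a * b) * (1 / (2 * b)) = 1 / (a * b\<^sup>2)"
    using ab by (simp add: power2_eq_square field_simps)
  moreover have "2 / (a * b) * (b - a) = 2 / a - 2 / b"
    using ab by (simp add: field_simps)
  ultimately have "1 / (a * b\<^sup>2) \<le> 2 / a - 2 / b"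
    by argo
  moreover have "1 / (b * b\<^sup>2) \<le> 1 / (a * b\<^sup>2)"
    using ab by (intro divide_left_mono mult_right_mono) auto
  ultimately have "1 / (real (Suc n) * b) \<le> 2 / a - 2 / b"
    unfolding ab(4) by (simp only: mult.commute)
  with Suc.IH show ?case
    unfolding sum.cl_ivl_Suc a_def b_def by simp
qed simp

text \<open>A sum whose block sums carry one boundary term of order \<open>(t + p) ^ (-1/2)\<close> and interior terms of order
\<open>1 / (t + r)\<close> is cut into consecutive blocks of lengths 1, 2, 3, and so on. Then the block of length \<open>q\<close>
starts near \<open>q\<^sup>2/2\<close>: its boundary term is of order \<open>1/q\<close>, and \<open>\<delta> r\<close> collects the
telescoping weights \<open>2/(q (q - 1))\<close> over \<open>q > r\<close>, which add up to \<open>2/r\<close>. There are about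
\<open>sqrt (2 n)\<close> blocks. The last block may be cut short at length \<open>p\<close>, and its boundary term is
absorbed by doubling the contribution of the boundary terms.\<close>

lemma triangular_block_sum:
  fixes V \<beta> \<delta> :: "nat \<Rightarrow> real" and c :: real
  assumes c: "0 \<le> c" and \<beta>: "\<And>m. 0 \<le> \<beta> m" and \<delta>: "\<And>m. 0 \<le> \<delta> m"
    and block: "\<And>t p. 1 \<le> p \<Longrightarrow> t + p \<le> n \<Longrightarrow>
      sum V {t<..t + p} \<le> c / sqrt (real (t + p)) * \<beta> p + (\<Sum>r=1..<p. \<delta> r / real (t + r))"
  shows "sum V {0<..n} \<le> (\<Sum>m = 1..nat \<lfloor>sqrt (2 * real n)\<rfloor>. (2 * sqrt 2 * c * \<beta> m + 2 * \<delta> m) / real m)"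
proof -
  define e where "e m = sqrt 2 * c * \<beta> m / real m" for m
  have nonneg: "0 \<le> e m" for m
    unfolding e_def using c \<beta> by simp
  define tri where "tri L = L * (L + 1) div 2" for L :: nat
  have tri_Suc: "tri (Suc L) = tri L + Suc L" for L
    unfolding tri_def by simp
  have tri_real: "real (tri L) = real L * (real L + 1) / 2" for L
  proof (induction L)
    case (Suc L)
    then show ?case
      by (simp add: tri_Suc) (simp add: field_simps)
  qed (simp add: tri_def)
  have tri_mono: "tri p \<le> tri L" if "p \<le> L" for p L
    unfolding tri_def using that by (intro div_le_mono mult_le_mono) simp_all
  have top: "c / sqrt (real u) * \<beta> p \<le> e p" if "1 \<le> p" "tri p \<le> u" for u p
  proof -
    have "(real p)\<^sup>2 / 2 \<le> real (tri p)"
      unfolding tri_real by (simp add: power2_eq_square field_simps)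
    also have "\<dots> \<le> real u"
      using that by simp
    finally have "sqrt ((real p)\<^sup>2 / 2) \<le> sqrt (real u)"
      by (rule real_sqrt_le_mono)
    then have "real p / sqrt 2 \<le> sqrt (real u)"
      by (simp add: real_sqrt_divide)
    moreover have "0 < real p / sqrt 2"
      using that by simp
    ultimately have "c * \<beta> p / sqrt (real u) \<le> c * \<beta> p / (real p / sqrt 2)"
      using c \<beta>[of p] by (intro divide_left_mono mult_pos_pos mult_nonneg_nonneg) linarith+
    then show ?thesis
      by (simp add: e_def mult_ac)
  qed
  \<comment> \<open>The weight of an interior term in the block of length \<open>L + 1\<close>, written as a telescoping difference.\<close>
  have gap: "2 / real L - 2 / (real L + 1) = 1 / (real L * (real L + 1) / 2)" if "0 < L" for L
    using that by (simp add: divide_simps)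
  have rest: "(\<Sum>r=1..<p. \<delta> r / real (tri L + r)) \<le> (\<Sum>r=1..L. \<delta> r * (2 / real L - 2 / (real L + 1)))"
    if "p \<le> Suc L" for p L
  proof -
    have "(\<Sum>r=1..<p. \<delta> r / real (tri L + r)) \<le> (\<Sum>r=1..<p. \<delta> r * (2 / real L - 2 / (real L + 1)))"
    proof (rule sum_mono)
      fix r assume r: "r \<in> {1..<p}"
      then have L: "0 < L" using that by auto
      have "\<delta> r / real (tri L + r) \<le> \<delta> r / (real L * (real L + 1) / 2)"
        unfolding of_nat_add tri_real using L \<delta>
        by (intro divide_left_mono mult_pos_pos add_pos_nonneg) auto
      also have "\<dots> = \<delta> r * (2 / real L - 2 / (real L + 1))"
        unfolding gap[OF L] by simp
      finally show "\<delta> r / real (tri L + r) \<le> \<delta> r * (2 / real L - 2 / (real L + 1))" .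
    qed
    also have "\<dots> \<le> (\<Sum>r=1..L. \<delta> r * (2 / real L - 2 / (real L + 1)))"
      using that \<delta> by (intro sum_mono2 mult_nonneg_nonneg) (auto simp: gap add.commute[of 1])
    finally show ?thesis .
  qed
  have full: "sum V {0<..tri L} \<le> (\<Sum>m=1..L. e m) + (\<Sum>r=1..L. \<delta> r * (2 / r - 2 / L))"
    if "tri L \<le> n" for L
    using that
  proof (induction L)
    case 0
    then show ?case by (simp add: tri_def)
  next
    case (Suc L)
    have "{0<..tri (Suc L)} = {0<..tri L} \<union> {tri L<..tri L + Suc L}"
      by (auto simp: tri_Suc)
    then have "sum V {0<..tri (Suc L)} = sum V {0<..tri L} + sum V {tri L<..tri L + Suc L}"
      by (simp add: sum.union_disjoint Int_def)
    also have "sum V {tri L<..tri L + Suc L} \<le> c / sqrt (real (tri L + Suc L)) * \<beta> (Suc L)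
        + (\<Sum>r=1..<Suc L. \<delta> r / real (tri L + r))"
      using Suc.prems by (intro block) (simp_all add: tri_Suc)
    also have "\<dots> \<le> e (Suc L) + (\<Sum>r=1..L. \<delta> r * (2 / real L - 2 / (real L + 1)))"
      by (intro add_mono top rest) (simp_all add: tri_Suc)
    also have "sum V {0<..tri L} \<le> (\<Sum>m=1..L. e m) + (\<Sum>r=1..L. \<delta> r * (2 / r - 2 / L))"
      using Suc.prems by (intro Suc.IH) (simp add: tri_Suc)
    finally have "sum V {0<..tri (Suc L)} \<le> (\<Sum>m=1..Suc L. e m)
        + ((\<Sum>r=1..L. \<delta> r * (2 / r - 2 / L))
        + (\<Sum>r=1..L. \<delta> r * (2 / real L - 2 / (real L + 1))))"
      by simp
    also have "(\<Sum>r=1..L. \<delta> r * (2 / r - 2 / L))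
        + (\<Sum>r=1..L. \<delta> r * (2 / real L - 2 / (real L + 1)))
        = (\<Sum>r=1..Suc L. \<delta> r * (2 / r - 2 / Suc L))"
      by (simp add: sum.distrib[symmetric] distrib_left[symmetric] add.commute)
    finally show ?case .
  qed
  define L where "L = (GREATEST L. tri L \<le> n)"
  have L_bound: "L' \<le> n" if "tri L' \<le> n" for L'
  proof -
    have "L' \<le> tri L'" by (induction L') (simp_all add: tri_Suc)
    with that show ?thesis by simp
  qed
  have L: "tri L \<le> n"
    unfolding L_def by (rule GreatestI_nat[of _ 0 n]) (auto simp: tri_def[of 0] L_bound)
  have "\<not> tri (Suc L) \<le> n"
  proof
    assume "tri (Suc L) \<le> n"
    then have "Suc L \<le> L"
      unfolding L_def by (rule Greatest_le_nat) (rule L_bound)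
    then show False by simp
  qed
  then have "n = tri L + (n - tri L)" "n - tri L \<le> L"
    using L by (simp_all add: tri_Suc)
  then obtain p where p: "n = tri L + p" "p \<le> L"
    by blast
  have "real L ^ 2 \<le> 2 * real n"
  proof -
    have "real (tri L) \<le> real n" using L by simp
    then show ?thesis unfolding tri_real by (simp add: power2_eq_square algebra_simps)
  qed
  then have LK: "L \<le> nat \<lfloor>sqrt (2 * real n)\<rfloor>"
    by (intro le_nat_floor real_le_rsqrt)
  have merge: "(\<Sum>m=1..L. 2 * e m) + (\<Sum>r=1..L. \<delta> r * (2 / r))
      = (\<Sum>m=1..L. (2 * sqrt 2 * c * \<beta> m + 2 * \<delta> m) / real m)"
    unfolding sum.distrib[symmetric] by (intro sum.cong refl) (simp add: e_def add_divide_distrib mult_ac)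
  have "sum V {0<..n} \<le> (\<Sum>m=1..L. (2 * sqrt 2 * c * \<beta> m + 2 * \<delta> m) / real m)"
  proof (cases "p = 0")
    case True
    have "sum V {0<..n} \<le> (\<Sum>m=1..L. e m) + (\<Sum>r=1..L. \<delta> r * (2 / r - 2 / L))"
      using full[OF L] p True by simp
    also have "\<dots> \<le> (\<Sum>m=1..L. 2 * e m) + (\<Sum>r=1..L. \<delta> r * (2 / r))"
      using nonneg by (intro add_mono sum_mono mult_left_mono \<delta>) simp_all
    finally show ?thesis
      unfolding merge .
  next
    case False
    have "{0<..n} = {0<..tri L} \<union> {tri L<..tri L + p}"
      using p(1) by auto
    then have "sum V {0<..n} = sum V {0<..tri L} + sum V {tri L<..tri L + p}"
      by (simp add: sum.union_disjoint Int_def)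
    also have "sum V {tri L<..tri L + p} \<le> c / sqrt (real (tri L + p)) * \<beta> p
        + (\<Sum>r=1..<p. \<delta> r / real (tri L + r))"
      using False p by (intro block) auto
    also have "\<dots> \<le> e p + (\<Sum>r=1..L. \<delta> r * (2 / real L - 2 / (real L + 1)))"
      using p False tri_mono[of p L] by (intro add_mono top rest) auto
    also have "e p \<le> (\<Sum>m=1..L. e m)"
      using p False nonneg by (intro member_le_sum[of p _ e]) auto
    also note full[OF L]
    finally have "sum V {0<..n} \<le> (\<Sum>m=1..L. e m) + (\<Sum>m=1..L. e m)
       + ((\<Sum>r=1..L. \<delta> r * (2 / r - 2 / L))
        + (\<Sum>r=1..L. \<delta> r * (2 / real L - 2 / (real L + 1))))"
      by simp
    also have "(\<Sum>r=1..L. \<delta> r * (2 / r - 2 / L))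
        + (\<Sum>r=1..L. \<delta> r * (2 / real L - 2 / (real L + 1)))
        \<le> (\<Sum>r=1..L. \<delta> r * (2 / r))"
      unfolding sum.distrib[symmetric] distrib_left[symmetric]
    proof (intro sum_mono mult_left_mono \<delta>)
      show "2 / real r - 2 / real L + (2 / real L - 2 / (real L + 1)) \<le> 2 / real r" for r
        by simp
    qed
    finally have "sum V {0<..n} \<le> 2 * (\<Sum>m=1..L. e m) + (\<Sum>r=1..L. \<delta> r * (2 / r))"
      by linarith
    then show ?thesis
      unfolding merge[symmetric] sum_distrib_left .
  qed
  also have "\<dots> \<le> (\<Sum>m = 1..nat \<lfloor>sqrt (2 * real n)\<rfloor>. (2 * sqrt 2 * c * \<beta> m + 2 * \<delta> m) / real m)"
    using LK c \<beta> \<delta> by (intro sum_mono2) auto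
  finally show ?thesis .
qed

section \<open>The smoothed test functions\<close>

text \<open>A convenient upper bound for the first absolute moment of the standard normal law.\<close>

abbreviation \<kappa> :: real where
  "\<kappa> \<equiv> sqrt (2 / 3)"

lemma kappa_bounds: "(sqrt 2 + 1) * \<kappa> \<le> 2" "\<kappa> * sqrt 2 + 147 / 160 \<le> 13 / 6"
proof -
  have "\<kappa> * sqrt 2 = sqrt (4 / 3)"
    by (simp flip: real_sqrt_mult)
  also have "\<dots> \<le> 1.16"
    by (rule real_le_lsqrt) (simp_all add: power2_eq_square)
  finally have 1: "\<kappa> * sqrt 2 \<le> 1.16" .
  have 2: "\<kappa> \<le> 0.82"
    by (rule real_le_lsqrt) (simp_all add: power2_eq_square)
  show "(sqrt 2 + 1) * \<kappa> \<le> 2"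
    using 1 2 by (simp add: algebra_simps)
  show "\<kappa> * sqrt 2 + 147 / 160 \<le> 13 / 6"
    using 1 by simp
qed

context
  fixes f :: "real \<Rightarrow> real" and \<sigma> :: real
  assumes f: "1-lipschitz_on UNIV f" and \<sigma>: "0 < \<sigma>"
begin

text \<open>The \<open>k\<close>-th derivative of \<open>f\<close> smoothed by a centred Gaussian of variance \<open>j \<sigma>\<^sup>2\<close>. In the Lindeberg
argument \<open>j - 1\<close> of the summands have already become Gaussian, and one extra Gaussian keeps \<open>j\<close>
positive.\<close>

definition smoothed :: "nat \<Rightarrow> nat \<Rightarrow> real \<Rightarrow> real" where
  "smoothed k j = gauss_deriv k (\<sigma> * sqrt (real j)) f"

lemma scale_pos: "1 \<le> j \<Longrightarrow> 0 < \<sigma> * sqrt (real j)"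
  using \<sigma> by simp

lemma scale_square: "(\<sigma> * sqrt (real j))\<^sup>2 = real j * \<sigma>\<^sup>2"
  by (simp add: power_mult_distrib)

lemma smoothed_measurable [measurable]: "1 \<le> j \<Longrightarrow> smoothed k j \<in> borel_measurable borel"
  unfolding smoothed_def by (intro gauss_deriv_measurable f scale_pos)

lemma smoothed_lipschitz:
  assumes "1 \<le> j"
  shows "1-lipschitz_on UNIV (smoothed 0 j)"
  using gauss_deriv_lipschitz[OF f scale_pos[OF assms], of 0]
  by (intro lipschitz_onI) (simp_all add: smoothed_def dist_real_def hermite_L1_0)

lemma smoothed_1_bound: "1 \<le> j \<Longrightarrow> \<bar>smoothed 1 j x\<bar> \<le> 1"
  using gauss_deriv_Suc_bound[OF f scale_pos, of j 0 x] by (simp add: smoothed_def hermite_L1_0)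

lemma smoothed_2_bound: 
  assumes "1 \<le> j"
  shows "\<bar>smoothed 2 j x\<bar> \<le> \<kappa> / (\<sigma> * sqrt (real j))"
proof -
  have "\<bar>smoothed 2 j x\<bar> \<le> hermite_L1 1 / (\<sigma> * sqrt (real j))"
    using gauss_deriv_Suc_bound[OF f scale_pos[OF assms], of 1 x]
    by (simp add: smoothed_def numeral_2_eq_2)
  also have "\<dots> \<le> \<kappa> / (\<sigma> * sqrt (real j))"
    using hermite_L1_1 scale_pos[OF assms] by (intro divide_right_mono) auto
  finally show ?thesis .
qed

lemma smoothed_2_lipschitz:
  assumes "1 \<le> j"
  shows "\<bar>smoothed 2 j x - smoothed 2 j x'\<bar> \<le> \<bar>x - x'\<bar> / (real j * \<sigma>\<^sup>2)"
proof -
  have "\<bar>smoothed 2 j x - smoothed 2 j x'\<bar> \<le> hermite_L1 2 / (real j * \<sigma>\<^sup>2) * \<bar>x - x'\<bar>"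
    using gauss_deriv_lipschitz[OF f scale_pos[OF assms], of 2 x x'] unfolding scale_square
    by (simp add: smoothed_def)
  also have "\<dots> \<le> 1 / (real j * \<sigma>\<^sup>2) * \<bar>x - x'\<bar>"
    using hermite_L1_2 by (intro mult_right_mono divide_right_mono) auto
  finally show ?thesis by simp
qed

lemma smoothed_taylor:
  assumes "1 \<le> j"
  shows "\<bar>smoothed 0 j (x + h) - smoothed 0 j x - h * smoothed 1 j x - h\<^sup>2 / 2 * smoothed 2 j x\<bar>
    \<le> \<bar>h\<bar> ^ 3 / (6 * (real j * \<sigma>\<^sup>2))"
proof -
  have "\<bar>smoothed 0 j (x + h) - smoothed 0 j x - h * smoothed 1 j x - h\<^sup>2 / 2 * smoothed 2 j x\<bar>
      \<le> hermite_L1 2 / (real j * \<sigma>\<^sup>2) * \<bar>h\<bar> ^ 3 / 6"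
    using gauss_deriv_taylor[OF f scale_pos[OF assms], of 0 x h 2]
    unfolding scale_square add_0 smoothed_def[symmetric]
    by (simp add: numeral_2_eq_2 eval_nat_numeral algebra_simps)
  also have "\<dots> \<le> 1 / (real j * \<sigma>\<^sup>2) * \<bar>h\<bar> ^ 3 / 6"
    using hermite_L1_2 by (intro mult_right_mono divide_right_mono) auto
  finally show ?thesis by (simp add: mult_ac)
qed

lemma smoothed_Suc:
  assumes "1 \<le> j"
  shows "smoothed k (Suc j) x = (\<integral>y. smoothed k j (x + \<sigma> * y) \<partial>\<gamma>)"
proof -
  have "sqrt (\<sigma>\<^sup>2 + (\<sigma> * sqrt (real j))\<^sup>2) = sqrt (\<sigma>\<^sup>2 * real (Suc j))"
    unfolding scale_square by (simp add: algebra_simps)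
  also have "\<dots> = \<sigma> * sqrt (real (Suc j))"
    using \<sigma> by (simp add: real_sqrt_mult)
  finally show ?thesis
    unfolding smoothed_def gauss_deriv_semigroup[OF f scale_pos[OF assms] \<sigma>] by simp
qed

lemma smoothed_integrable: "1 \<le> j \<Longrightarrow> integrable \<gamma> (\<lambda>y. smoothed k j (x + \<sigma> * y))"
  unfolding smoothed_def by (intro gauss_deriv_integrable f scale_pos)

lemma gauss_abs_moment: "integrable \<gamma> (\<lambda>y. \<bar>y\<bar>)" "(\<integral>y. \<bar>y\<bar> \<partial>\<gamma>) \<le> \<kappa>"
  using integrable_std_normal_distribution_moment[of 1] hermite_L1_1
  by (simp_all add: hermite_L1_def pderiv_1)

lemma smoothed_2_Suc:
  assumes "1 \<le> j"
  shows "\<bar>smoothed 2 j x - smoothed 2 (Suc j) x\<bar> \<le> \<kappa> / (real j * \<sigma>)"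
proof -
  note int = smoothed_integrable[OF assms, of 2 x]
  have "\<bar>smoothed 2 j x - smoothed 2 (Suc j) x\<bar> = \<bar>\<integral>y. smoothed 2 j x - smoothed 2 j (x + \<sigma> * y) \<partial>\<gamma>\<bar>"
    unfolding smoothed_Suc[OF assms] using int \<gamma>.prob_space by simp
  also have "\<dots> \<le> (\<integral>y. \<bar>smoothed 2 j x - smoothed 2 j (x + \<sigma> * y)\<bar> \<partial>\<gamma>)"
    by (rule integral_abs_bound)
  also have "\<dots> \<le> (\<integral>y. \<bar>y\<bar> * (\<sigma> / (real j * \<sigma>\<^sup>2)) \<partial>\<gamma>)"
  proof (rule integral_mono)
    show "\<bar>smoothed 2 j x - smoothed 2 j (x + \<sigma> * y)\<bar> \<le> \<bar>y\<bar> * (\<sigma> / (real j * \<sigma>\<^sup>2))" for y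
      using smoothed_2_lipschitz[OF assms, of x "x + \<sigma> * y"] \<sigma> by (simp add: abs_mult mult_ac)
  qed (use int gauss_abs_moment in auto)
  also have "\<dots> \<le> \<kappa> * (\<sigma> / (real j * \<sigma>\<^sup>2))"
    using gauss_abs_moment \<sigma> by (simp add: mult_right_mono divide_right_mono)
  finally show ?thesis
    using \<sigma> by (simp add: power2_eq_square)
qed

text \<open>Adding one more Gaussian of variance \<open>\<sigma>\<^sup>2\<close> matches the second-order term up to a fourth-order
error, because the odd Gaussian moments vanish. This makes the error summable in \<open>j\<close>; a
third-order error would cost a second logarithm.\<close>

lemma smoothed_0_Suc:
  assumes "1 \<le> j"
  shows "\<bar>smoothed 0 (Suc j) x - smoothed 0 j x - \<sigma>\<^sup>2 / 2 * smoothed 2 j x\<bar>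
    \<le> 49 * \<sigma> / 160 * (1 / (real j * sqrt (real j)))"
proof -
  note int = smoothed_integrable[OF assms, of 0 x]
  note [simp] = integrable_std_normal_distribution_moment
    integrable_std_normal_distribution_moment[of 1, simplified]
  let ?P = "\<lambda>y. \<Sum>m\<le>3. smoothed m j x * (\<sigma> * y) ^ m / fact m"
  have P: "?P y = smoothed 0 j x + smoothed 1 j x * \<sigma> * y + smoothed 2 j x * \<sigma>\<^sup>2 / 2 * y\<^sup>2
      + smoothed 3 j x * \<sigma> ^ 3 / 6 * y ^ 3" for y
    by (simp add: eval_nat_numeral power2_eq_square mult_ac)
  have P_int: "integrable \<gamma> ?P"
    unfolding P by simp
  have "(\<integral>y. ?P y \<partial>\<gamma>) = smoothed 0 j x + \<sigma>\<^sup>2 / 2 * smoothed 2 j x"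
    unfolding P using \<gamma>.prob_space by (simp add: gauss_moments)
  then have "\<bar>smoothed 0 (Suc j) x - smoothed 0 j x - \<sigma>\<^sup>2 / 2 * smoothed 2 j x\<bar>
      = \<bar>\<integral>y. smoothed 0 j (x + \<sigma> * y) - ?P y \<partial>\<gamma>\<bar>"
    unfolding smoothed_Suc[OF assms] using int P_int by simp
  also have "\<dots> \<le> (\<integral>y. \<bar>smoothed 0 j (x + \<sigma> * y) - ?P y\<bar> \<partial>\<gamma>)"
    by (rule integral_abs_bound)
  also have "\<dots> \<le> (\<integral>y. hermite_L1 3 / (\<sigma> * sqrt (real j)) ^ 3 * \<sigma> ^ 4 / 24 * y ^ 4 \<partial>\<gamma>)"
  proof (rule integral_mono)
    show "\<bar>smoothed 0 j (x + \<sigma> * y) - ?P y\<bar>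
        \<le> hermite_L1 3 / (\<sigma> * sqrt (real j)) ^ 3 * \<sigma> ^ 4 / 24 * y ^ 4" for y
      using gauss_deriv_taylor[OF f scale_pos[OF assms], of 0 x "\<sigma> * y" 3]
      unfolding add_0 smoothed_def[symmetric]
      by (simp add: fact_numeral abs_mult power_mult_distrib power_even_abs)
  qed (use int P_int in auto)
  also have "\<dots> = hermite_L1 3 * (\<sigma> / (8 * (real j * sqrt (real j))))"
  proof -
    have "(\<sigma> * sqrt (real j)) ^ 3 = \<sigma> ^ 3 * (real j * sqrt (real j))"
      by (simp add: power_mult_distrib power3_eq_cube)
    moreover have "\<sigma> ^ 4 = \<sigma> ^ 3 * \<sigma>"
      by (simp add: eval_nat_numeral)
    ultimately show ?thesis
      using \<sigma> by (simp add: gauss_moments)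
  qed
  also have "\<dots> \<le> 49 / 20 * (\<sigma> / (8 * (real j * sqrt (real j))))"
    using hermite_L1_3 \<sigma> by (intro mult_right_mono) auto
  finally show ?thesis by simp
qed

lemma smoothed_1_close: "\<bar>f x - smoothed 0 1 x\<bar> \<le> \<kappa> * \<sigma>"
proof -
  have int: "integrable \<gamma> (\<lambda>y. f (x + \<sigma> * y))"
    using integrable_gauss_lipschitz_poly[OF f, of x \<sigma> 1] by simp
  have "\<bar>f x - smoothed 0 1 x\<bar> = \<bar>\<integral>y. f x - f (x + \<sigma> * y) \<partial>\<gamma>\<bar>"
    using int \<gamma>.prob_space by (simp add: smoothed_def gauss_deriv_def)
  also have "\<dots> \<le> (\<integral>y. \<bar>f x - f (x + \<sigma> * y)\<bar> \<partial>\<gamma>)"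
    by (rule integral_abs_bound)
  also have "\<dots> \<le> (\<integral>y. \<bar>y\<bar> * \<sigma> \<partial>\<gamma>)"
  proof (rule integral_mono)
    show "\<bar>f x - f (x + \<sigma> * y)\<bar> \<le> \<bar>y\<bar> * \<sigma>" for y
      using lipschitz_onD[OF f, of x "x + \<sigma> * y"] \<sigma> by (simp add: dist_real_def abs_mult mult_ac)
  qed (use int gauss_abs_moment in auto)
  also have "\<dots> \<le> \<kappa> * \<sigma>"
    using gauss_abs_moment \<sigma> by simp
  finally show ?thesis .
qed

text \<open>Coupling the two Gaussians through the same normal variable, so that their difference has scale
\<open>sqrt (n + 1) - sqrt n \<le> sqrt 2 - 1\<close>, is better here than using independent increments.\<close>

lemma smoothed_end:
  assumes "1 \<le> n"
  shows "\<bar>smoothed 0 (Suc n) 0 - (\<integral>y. f (\<sigma> * sqrt (real n) * y) \<partial>\<gamma>)\<bar> \<le> \<kappa> * \<sigma> * (sqrt 2 - 1)"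
proof -
  have int: "integrable \<gamma> (\<lambda>y. f (s * y))" for s
    using integrable_gauss_lipschitz_poly[OF f, of 0 s 1] by simp
  let ?a = "\<sigma> * sqrt (real (Suc n))" and ?b = "\<sigma> * sqrt (real n)"
  have "sqrt (real (Suc n)) - sqrt (real n) \<le> sqrt 2 - 1"
  proof -
    have "(sqrt (real (Suc n)) - sqrt (real n)) * (sqrt (real (Suc n)) + sqrt (real n)) = 1"
      by (simp add: algebra_simps)
    then have "sqrt (real (Suc n)) - sqrt (real n) = 1 / (sqrt (real (Suc n)) + sqrt (real n))"
      using assms by (subst eq_divide_eq) auto
    also have "\<dots> \<le> 1 / (sqrt 2 + 1)"
      using assms by (intro divide_left_mono add_mono mult_pos_pos add_pos_nonneg) auto
    also have "\<dots> = sqrt 2 - 1"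
    proof -
      have "sqrt 2 + 1 \<noteq> (0 :: real)"
        using real_sqrt_ge_zero[of 2] by linarith
      then show ?thesis
        by (subst divide_eq_eq) (simp add: algebra_simps)
    qed
    finally show ?thesis .
  qed
  then have ab: "0 \<le> ?a - ?b" "?a - ?b \<le> \<sigma> * (sqrt 2 - 1)"
    using \<sigma> by (simp_all flip: right_diff_distrib)
  have "\<bar>smoothed 0 (Suc n) 0 - (\<integral>y. f (?b * y) \<partial>\<gamma>)\<bar> = \<bar>\<integral>y. f (?a * y) - f (?b * y) \<partial>\<gamma>\<bar>"
    using int by (simp add: smoothed_def gauss_deriv_def)
  also have "\<dots> \<le> (\<integral>y. \<bar>f (?a * y) - f (?b * y)\<bar> \<partial>\<gamma>)"
    by (rule integral_abs_bound)
  also have "\<dots> \<le> (\<integral>y. \<bar>y\<bar> * (?a - ?b) \<partial>\<gamma>)"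
  proof (rule integral_mono)
    show "\<bar>f (?a * y) - f (?b * y)\<bar> \<le> \<bar>y\<bar> * (?a - ?b)" for y
    proof -
      have "\<bar>f (?a * y) - f (?b * y)\<bar> \<le> \<bar>(?a - ?b) * y\<bar>"
        using lipschitz_onD[OF f, of "?a * y" "?b * y"] by (simp add: dist_real_def left_diff_distrib)
      then show ?thesis using ab by (simp add: abs_mult mult.commute)
    qed
  qed (use int gauss_abs_moment in auto)
  also have "\<dots> \<le> \<kappa> * (?a - ?b)"
    using gauss_abs_moment ab by (simp add: mult_right_mono)
  also have "\<dots> \<le> \<kappa> * (\<sigma> * (sqrt 2 - 1))"
    using ab by (intro mult_left_mono) auto
  finally show ?thesis by (simp add: mult_ac)
qed

end

lemma integrable_mult_bounded:
  fixes g h :: "'a \<Rightarrow> real"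
  assumes h: "integrable M h" and g: "g \<in> borel_measurable M"
    and K: "\<And>x. x \<in> space M \<Longrightarrow> \<bar>g x\<bar> \<le> K"
  shows "integrable M (\<lambda>x. g x * h x)"
proof (rule Bochner_Integration.integrable_bound)
  show "integrable M (\<lambda>x. K * h x)"
    using h by simp
  show "(\<lambda>x. g x * h x) \<in> borel_measurable M"
    using g borel_measurable_integrable[OF h] by simp
  have "\<bar>g x\<bar> * \<bar>h x\<bar> \<le> \<bar>K\<bar> * \<bar>h x\<bar>" if "x \<in> space M" for x
    using K[OF that] by (intro mult_right_mono) linarith+
  then show "AE x in M. norm (g x * h x) \<le> norm (K * h x)"
    by (intro AE_I2) (simp add: abs_mult)
qed

section \<open>Stationary martingale differences\<close>

text \<open>Partial sums from time 1 on involve only times \<open>k \<ge> 0\<close>, so the natural powers of \<open>T\<close> suffice for the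
shifts. The condition \<open>mds\<close> says that \<open>X\<^sub>k\<^sub>+\<^sub>1\<close> has conditional mean zero given the past up to time \<open>k\<close>.\<close>

locale stationary_mds = prob_space M for M :: "'a measure" +
  fixes T :: "'a \<Rightarrow> 'a" and F :: "'a measure" and X0 :: "'a \<Rightarrow> real" and \<sigma> :: real
  assumes mpt: "bimeasurable_mpt M T"
    and F_sub: "subalgebra M F"
    and F_shift: "sets F \<subseteq> sets (vimage_algebra (space M) T F)"
    and X0_F: "X0 \<in> borel_measurable F"
    and X0_cube: "integrable M (\<lambda>x. \<bar>X0 x\<bar> ^ 3)"
    and mds: "\<And>k. AE x in M. real_cond_exp M (vimage_algebra (space M) (T ^^ k) F)
      (\<lambda>x. X0 ((T ^^ Suc k) x)) x = 0"
    and \<sigma>_pos: "0 < \<sigma>"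
begin

text \<open>The \<open>\<sigma>\<close>-algebra of the events known at time \<open>k\<close>.\<close>

definition A :: "nat \<Rightarrow> 'a measure" where
  "A k = vimage_algebra (space M) (T ^^ k) F"

definition X :: "nat \<Rightarrow> 'a \<Rightarrow> real" where
  "X k x = X0 ((T ^^ k) x)"

definition S :: "nat \<Rightarrow> 'a \<Rightarrow> real" where
  "S n x = (\<Sum>i=1..n. X i x)"

definition sq_sum :: "nat \<Rightarrow> 'a \<Rightarrow> real" where
  "sq_sum m y = (\<Sum>i=1..m. (X i y)\<^sup>2)"

definition U :: "nat \<Rightarrow> 'a \<Rightarrow> real" where
  "U m x = real_cond_exp M F (sq_sum m) x - real m * \<sigma>\<^sup>2"

lemma T_bij: "bij_betw T (space M) (space M)"
  and T_meas [measurable]: "T \<in> measurable M M"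
  and T_distr: "distr M M T = M"
  using mpt by (auto simp: bimeasurable_mpt_def)

lemma space_F: "space F = space M" and sets_F: "sets F \<subseteq> sets M"
  using F_sub by (auto simp: subalgebra_def)

sublocale F: finite_measure_subalgebra M F
  by unfold_locales (rule F_sub)

lemma iter_bij: "bij_betw (T ^^ k) (space M) (space M)"
  using T_bij by (rule bij_betw_funpow)

lemma iter_space: "x \<in> space M \<Longrightarrow> (T ^^ k) x \<in> space M"
  using iter_bij by (auto simp: bij_betw_def)

lemma iter_meas [measurable]: "(T ^^ k) \<in> measurable M M"
  by (induction k) (auto simp: id_def intro: measurable_comp)

lemma iter_distr: "distr M M (T ^^ k) = M"
proof (induction k)
  case (Suc k)
  have "distr M M (T ^^ Suc k) = distr (distr M M (T ^^ k)) M T"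
    by (subst distr_distr) auto
  then show ?case unfolding Suc T_distr .
qed (simp add: id_def distr_id)

lemma integral_iter:
  "h \<in> borel_measurable M \<Longrightarrow> (\<integral>x. h ((T ^^ k) x) \<partial>M) = (\<integral>x. h x \<partial>M)" for h :: "'a \<Rightarrow> real"
  using integral_distr[OF iter_meas[of k], of h] by (simp add: iter_distr)

lemma integrable_iter:
  "integrable M h \<Longrightarrow> integrable M (\<lambda>x. h ((T ^^ k) x))" for h :: "'a \<Rightarrow> real"
  using integrable_distr[OF iter_meas[of k], of h] by (simp add: iter_distr)

lemma X_shift: "X (l + i) x = X i ((T ^^ l) x)"
  by (simp add: X_def add.commute[of l] funpow_add)

lemma S_Suc: "S (Suc n) x = S n x + X (Suc n) x"
  by (simp add: S_def)

lemma X0_M [measurable]: "X0 \<in> borel_measurable M"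
  by (rule measurable_from_subalg[OF F_sub X0_F])

lemma X_M [measurable]: "X k \<in> borel_measurable M"
  unfolding X_def[abs_def] by simp

lemma S_M [measurable]: "S k \<in> borel_measurable M"
  unfolding S_def[abs_def] by simp

lemma A_space: "space (A k) = space M"
  by (simp add: A_def)

lemma iter_in_F: "(T ^^ k) \<in> space M \<rightarrow> space F"
  using iter_space by (auto simp: space_F)

lemma sets_A: "sets (A k) = {(T ^^ k) -` B \<inter> space M | B. B \<in> sets F}"
  unfolding A_def by (rule sets_vimage_algebra2[OF iter_in_F])

lemma A_sub: "subalgebra M (A k)"
  unfolding subalgebra_def
proof
  show "sets (A k) \<subseteq> sets M"
    unfolding sets_A using sets_F measurable_sets[OF iter_meas[of k]] by auto
qed (rule A_space)

lemma A_mono: "sets (A k) \<subseteq> sets (A (Suc k))"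
proof
  fix C assume "C \<in> sets (A k)"
  then obtain B where B: "B \<in> sets F" "C = (T ^^ k) -` B \<inter> space M"
    unfolding sets_A by auto
  with F_shift obtain D where D: "D \<in> sets F" "B = T -` D \<inter> space M"
    using sets_A[of 1] by (auto simp: A_def)
  have "C = (T ^^ Suc k) -` D \<inter> space M"
    unfolding B D using iter_space by auto
  with D show "C \<in> sets (A (Suc k))"
    unfolding sets_A by auto
qed

lemma A_mono': "i \<le> k \<Longrightarrow> sets (A i) \<subseteq> sets (A k)"
  by (rule lift_Suc_mono_le[of "\<lambda>k. sets (A k)"]) (use A_mono in auto)

lemma X_adapted:
  assumes "i \<le> k"
  shows "X i \<in> borel_measurable (A k)"
proof -
  have "(T ^^ i) \<in> measurable (A i) F"
    unfolding A_def by (rule measurable_vimage_algebra1[OF iter_in_F])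
  then have "X i \<in> borel_measurable (A i)"
    unfolding X_def[abs_def] using X0_F by (rule measurable_compose)
  moreover have "subalgebra (A k) (A i)"
    using A_mono'[OF assms] by (simp add: subalgebra_def A_space)
  ultimately show ?thesis
    by (rule measurable_from_subalg[rotated])
qed

lemma S_adapted: "S k \<in> borel_measurable (A k)"
  unfolding S_def[abs_def] by (intro borel_measurable_sum X_adapted) auto

text \<open>As \<open>T\<close> is invertible, a variable known at time \<open>k\<close> is a variable known at time \<open>0\<close> shifted by \<open>k\<close>. This
lets conditional expectations at time \<open>k\<close> be evaluated at time \<open>0\<close>.\<close>

lemma past_factor:
  assumes g: "g \<in> borel_measurable (A k)"
  obtains g' :: "'a \<Rightarrow> real" where "g' \<in> borel_measurable F" "\<And>x. x \<in> space M \<Longrightarrow> g x = g' ((T ^^ k) x)"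
proof
  let ?inv = "the_inv_into (space M) (T ^^ k)"
  have inj: "inj_on (T ^^ k) (space M)" and surj: "(T ^^ k) ` space M = space M"
    using iter_bij[of k] by (auto simp: bij_betw_def)
  show "g x = (g \<circ> ?inv) ((T ^^ k) x)" if "x \<in> space M" for x
    using that inj by (simp add: the_inv_into_f_f)
  show "g \<circ> ?inv \<in> borel_measurable F"
  proof (rule measurableI)
    fix B :: "real set" assume "B \<in> sets borel"
    with g have "g -` B \<inter> space M \<in> sets (A k)"
      using measurable_sets[OF g] A_space by metis
    then obtain D where D: "D \<in> sets F" "g -` B \<inter> space M = (T ^^ k) -` D \<inter> space M"
      unfolding sets_A by auto
    have "(g \<circ> ?inv) -` B \<inter> space F = D"
    proof (intro set_eqI iffI)
      fix y assume "y \<in> (g \<circ> ?inv) -` B \<inter> space F"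
      then have y: "y \<in> space M" "g (?inv y) \<in> B"
        by (auto simp: space_F)
      then obtain x where "x \<in> space M" "y = (T ^^ k) x"
        using surj by blast
      with y inj D(2) show "y \<in> D"
        by (auto simp: the_inv_into_f_f)
    next
      fix y assume y: "y \<in> D"
      then have "y \<in> space M"
        using sets.sets_into_space[OF D(1)] space_F by auto
      then obtain x where x: "x \<in> space M" "y = (T ^^ k) x"
        using surj by blast
      with y inj D(2) have "x \<in> g -` B \<inter> space M" by auto
      with x inj y show "y \<in> (g \<circ> ?inv) -` B \<inter> space F"
        using iter_space by (auto simp: the_inv_into_f_f space_F)
    qed
    with D show "(g \<circ> ?inv) -` B \<inter> space F \<in> sets F"
      by simp
  qed auto
qed

lemma X0_square: "integrable M (\<lambda>x. (X0 x)\<^sup>2)"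
proof (rule Bochner_Integration.integrable_bound[of _ "\<lambda>x. 1 + \<bar>X0 x\<bar> ^ 3"])
  have "\<bar>z\<bar>\<^sup>2 \<le> 1 + \<bar>z\<bar> ^ 3" for z :: real
  proof (cases "\<bar>z\<bar> \<le> 1")
    case True
    then have "\<bar>z\<bar>\<^sup>2 \<le> 1" by (intro power_le_one) auto
    moreover have "0 \<le> \<bar>z\<bar> ^ 3" by simp
    ultimately show ?thesis by linarith
  next
    case False
    then have "\<bar>z\<bar>\<^sup>2 \<le> \<bar>z\<bar> ^ 3" by (intro power_increasing) auto
    then show ?thesis by simp
  qed
  then show "AE x in M. norm ((X0 x)\<^sup>2) \<le> norm (1 + \<bar>X0 x\<bar> ^ 3)"
    by (intro AE_I2) simp
qed (use X0_cube in auto)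

lemma X0_int: "integrable M X0"
proof (rule Bochner_Integration.integrable_bound[of _ "\<lambda>x. 1 + (X0 x)\<^sup>2"])
  have "\<bar>z\<bar> \<le> 1 + z\<^sup>2" for z :: real
    using zero_le_power2[of "\<bar>z\<bar> - 1"] by (simp add: power2_eq_square algebra_simps)
  then show "AE x in M. norm (X0 x) \<le> norm (1 + (X0 x)\<^sup>2)"
    by (intro AE_I2) simp
qed (use X0_square in auto)

lemma X_int: "integrable M (X k)" 
  unfolding X_def[abs_def] by (rule integrable_iter[OF X0_int])

lemma X_square: "integrable M (\<lambda>x. (X k x)\<^sup>2)"
  unfolding X_def[abs_def] by (rule integrable_iter[OF X0_square])

lemma X_cube: "integrable M (\<lambda>x. \<bar>X k x\<bar> ^ 3)" "(\<integral>x. \<bar>X k x\<bar> ^ 3 \<partial>M) = (\<integral>x. \<bar>X0 x\<bar> ^ 3 \<partial>M)"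
  unfolding X_def[abs_def] using integrable_iter[OF X0_cube] integral_iter[of "\<lambda>x. \<bar>X0 x\<bar> ^ 3" k] by auto

lemma S_int: "integrable M (S n)"
  unfolding S_def[abs_def] by (intro Bochner_Integration.integrable_sum X_int)

lemma sq_sum_int: "integrable M (sq_sum m)"
  unfolding sq_sum_def[abs_def] by (intro Bochner_Integration.integrable_sum X_square)

lemma sq_sum_M [measurable]: "sq_sum m \<in> borel_measurable M"
  using sq_sum_int by (rule borel_measurable_integrable)

lemma U_int: "integrable M (U m)"
  unfolding U_def[abs_def] using F.real_cond_exp_int(1)[OF sq_sum_int] by simp

lemma X0_sq_sum_int: "integrable M (\<lambda>x. X0 x * sq_sum m x)"
proof (rule Bochner_Integration.integrable_bound[of _ "\<lambda>x. \<Sum>i=1..m. \<bar>X0 x\<bar> ^ 3 + \<bar>X i x\<bar> ^ 3"])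
  show "integrable M (\<lambda>x. \<Sum>i=1..m. \<bar>X0 x\<bar> ^ 3 + \<bar>X i x\<bar> ^ 3)"
    by (intro Bochner_Integration.integrable_sum Bochner_Integration.integrable_add X0_cube X_cube)
  have "\<bar>a\<bar> * b\<^sup>2 \<le> \<bar>a\<bar> ^ 3 + \<bar>b\<bar> ^ 3" for a b :: real
  proof -
    let ?m = "max \<bar>a\<bar> \<bar>b\<bar>"
    have "\<bar>a\<bar> * \<bar>b\<bar>\<^sup>2 \<le> ?m * ?m\<^sup>2"
      by (intro mult_mono power_mono) auto
    also have "\<dots> = ?m ^ 3"
      by (simp add: power3_eq_cube power2_eq_square)
    also have "\<dots> \<le> \<bar>a\<bar> ^ 3 + \<bar>b\<bar> ^ 3"
      by (auto simp: max_def)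
    finally show ?thesis by simp
  qed
  then have "\<bar>X0 x\<bar> * sq_sum m x \<le> (\<Sum>i=1..m. \<bar>X0 x\<bar> ^ 3 + \<bar>X i x\<bar> ^ 3)" for x
    unfolding sq_sum_def sum_distrib_left by (intro sum_mono)
  moreover have "\<bar>sq_sum m x\<bar> = sq_sum m x" for x
    unfolding sq_sum_def by (intro abs_of_nonneg sum_nonneg) auto
  ultimately have "\<bar>X0 x * sq_sum m x\<bar> \<le> \<bar>\<Sum>i=1..m. \<bar>X0 x\<bar> ^ 3 + \<bar>X i x\<bar> ^ 3\<bar>" for x
    unfolding abs_mult by (metis abs_ge_self order_trans)
  then show "AE x in M. norm (X0 x * sq_sum m x) \<le> norm (\<Sum>i=1..m. \<bar>X0 x\<bar> ^ 3 + \<bar>X i x\<bar> ^ 3)"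
    by simp
qed simp

text \<open>Pulling the factor \<open>X0\<close>, which is known at time 0, into the conditional expectation shows that the norms of
\<open>X0 * U m\<close> are always finite.\<close>

lemma X0_U_int: "integrable M (\<lambda>x. X0 x * U m x)"
  unfolding U_def[abs_def] right_diff_distrib
  using F.real_cond_exp_intg(1)[OF X0_sq_sum_int X0_F sq_sum_M] X0_int
  by simp

definition \<alpha> :: "nat \<Rightarrow> real" where
  "\<alpha> m = (\<integral>x. \<bar>X0 x * U m x\<bar> \<partial>M)"

definition \<beta> :: "nat \<Rightarrow> real" where
  "\<beta> m = (\<integral>x. \<bar>U m x\<bar> \<partial>M)"

lemma \<alpha>_nonneg: "0 \<le> \<alpha> m" and \<beta>_nonneg: "0 \<le> \<beta> m"
  unfolding \<alpha>_def \<beta>_def by (intro integral_nonneg_AE; simp)+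

section \<open>Conditioning on the past\<close>

lemma mds_orthogonal:
  assumes g: "g \<in> borel_measurable (A k)" and K: "\<And>x. \<bar>g x\<bar> \<le> K"
  shows "(\<integral>x. X (Suc k) x * g x \<partial>M) = 0"
proof -
  interpret A: finite_measure_subalgebra M "A k"
    by unfold_locales (rule A_sub)
  have gM: "g \<in> borel_measurable M"
    using g by (rule measurable_from_subalg[OF A_sub])
  have "(\<integral>x. g x * X (Suc k) x \<partial>M) = (\<integral>x. g x * real_cond_exp M (A k) (X (Suc k)) x \<partial>M)"
    by (rule A.real_cond_exp_intg(2)[symmetric, OF integrable_mult_bounded[OF X_int gM K] g X_M])
  also have "\<dots> = (\<integral>x. 0 \<partial>M)"
    using mds[of k] gM by (intro integral_cong_AE) (auto simp: A_def X_def[abs_def])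
  finally show ?thesis by (simp add: mult.commute)
qed

text \<open>The deviation of the squares in the window \<open>{l + 1..l + m}\<close>, whose conditional expectation at time
\<open>l\<close> is \<open>U m\<close> shifted by \<open>l\<close>.\<close>

definition D :: "nat \<Rightarrow> nat \<Rightarrow> 'a \<Rightarrow> real" where
  "D l m x = (\<Sum>i=1..m. (X (l + i) x)\<^sup>2 - \<sigma>\<^sup>2)"

lemma D_eq: "D l m x = sq_sum m ((T ^^ l) x) - real m * \<sigma>\<^sup>2"
  by (simp add: D_def sq_sum_def X_shift sum_subtractf)

lemma D_int: "integrable M (D l m)"
  unfolding D_eq[abs_def] using integrable_iter[OF sq_sum_int] by simp

text \<open>The source of the norms of \<open>U m\<close> and \<open>X0 * U m\<close>: shifting back by \<open>l\<close> and conditioning on \<open>F\<close> replaces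
the window of squares by \<open>U m\<close> and \<open>X l\<close> by \<open>X0\<close>. The constant \<open>K\<close> only serves integrability.\<close>

lemma future_squares:
  assumes g: "g \<in> borel_measurable (A l)" and K: "\<And>x. \<bar>g x\<bar> \<le> K"
    and c: "0 \<le> c" "0 \<le> d" "\<And>x. \<bar>g x\<bar> \<le> c * \<bar>X l x\<bar> + d"
  shows "(\<integral>x. g x * D l m x \<partial>M) \<le> c * \<alpha> m + d * \<beta> m"
proof -
  obtain g' where g': "g' \<in> borel_measurable F" "\<And>x. x \<in> space M \<Longrightarrow> g x = g' ((T ^^ l) x)"
    using g by (rule past_factor) blast
  note g'(1)[THEN measurable_from_subalg[OF F_sub], measurable]
  have surj: "\<exists>x\<in>space M. y = (T ^^ l) x" if "y \<in> space M" for y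
    using iter_bij[of l] that by (auto simp: bij_betw_def)
  have K': "\<bar>g' y\<bar> \<le> K" and c': "\<bar>g' y\<bar> \<le> c * \<bar>X0 y\<bar> + d" if "y \<in> space M" for y
    using surj[OF that] g'(2) K c(3) X_def by metis+
  have int: "integrable M (\<lambda>y. g' y * h y)" if "integrable M h" for h
    using that K' by (intro integrable_mult_bounded) auto
  have "(\<integral>x. g x * D l m x \<partial>M) = (\<integral>x. (\<lambda>y. g' y * (sq_sum m y - real m * \<sigma>\<^sup>2)) ((T ^^ l) x) \<partial>M)"
    using g'(2) by (intro Bochner_Integration.integral_cong) (auto simp: D_eq)
  also have "\<dots> = (\<integral>y. g' y * (sq_sum m y - real m * \<sigma>\<^sup>2) \<partial>M)"
    by (rule integral_iter) simp
  also have "\<dots> = (\<integral>y. g' y * U m y \<partial>M)"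
    unfolding U_def right_diff_distrib
    using int[OF sq_sum_int] int[OF F.real_cond_exp_int(1)[OF sq_sum_int]] int[of "\<lambda>_. real m * \<sigma>\<^sup>2"]
      F.real_cond_exp_intg(2)[OF int[OF sq_sum_int] g'(1) sq_sum_M]
    by simp
  also have "\<dots> \<le> (\<integral>y. c * \<bar>X0 y * U m y\<bar> + d * \<bar>U m y\<bar> \<partial>M)"
  proof (rule integral_mono)
    fix y assume "y \<in> space M"
    have "g' y * U m y \<le> \<bar>g' y\<bar> * \<bar>U m y\<bar>"
      by (metis abs_ge_self abs_mult)
    also have "\<dots> \<le> (c * \<bar>X0 y\<bar> + d) * \<bar>U m y\<bar>"
      using c'[OF \<open>y \<in> space M\<close>] by (intro mult_right_mono) auto
    finally show "g' y * U m y \<le> c * \<bar>X0 y * U m y\<bar> + d * \<bar>U m y\<bar>"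
      by (simp add: abs_mult algebra_simps)
  qed (use int[OF U_int] X0_U_int U_int in auto)
  also have "\<dots> = c * \<alpha> m + d * \<beta> m"
    using X0_U_int U_int by (simp add: \<alpha>_def \<beta>_def)
  finally show ?thesis .
qed

section \<open>Lindeberg replacement\<close>

lemma smoothed_S_adapted:
  assumes "1-lipschitz_on UNIV f" "1 \<le> j"
  shows "(\<lambda>x. smoothed f \<sigma> k j (S l x)) \<in> borel_measurable (A l)"
  by (rule measurable_compose[OF S_adapted smoothed_measurable[OF assms(1) \<sigma>_pos assms(2)]])

text \<open>Twice the second-order term that remains when the summand with index \<open>n - j + 1\<close> is replaced.\<close>

definition V :: "(real \<Rightarrow> real) \<Rightarrow> nat \<Rightarrow> nat \<Rightarrow> real" where
  "V f n j = (\<integral>x. smoothed f \<sigma> 2 j (S (n - j) x) * ((X (Suc (n - j)) x)\<^sup>2 - \<sigma>\<^sup>2) \<partial>M)"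

lemma smoothed_2_mult_int:
  assumes "1-lipschitz_on UNIV f" "1 \<le> j" "integrable M h"
  shows "integrable M (\<lambda>x. smoothed f \<sigma> 2 j (S l x) * h x)"
proof (rule integrable_mult_bounded[OF assms(3)])
  show "(\<lambda>x. smoothed f \<sigma> 2 j (S l x)) \<in> borel_measurable M"
    by (rule measurable_compose[OF S_M smoothed_measurable[OF assms(1) \<sigma>_pos assms(2)]])
  show "\<bar>smoothed f \<sigma> 2 j (S l x)\<bar> \<le> \<kappa> / (\<sigma> * sqrt (real j))" for x
    by (rule smoothed_2_bound[OF assms(1) \<sigma>_pos assms(2)])
qed

text \<open>Summation by parts. On a block the coefficient \<open>smoothed f \<sigma> 2 j\<close>, evaluated at \<open>S (n - j)\<close>, is frozen at
its earliest time, that is at \<open>j = t + p\<close>; this leaves the whole window of squares, hence \<open>\<beta> p\<close>. The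
increments of the coefficient are at most \<open>\<bar>X (n - j)\<bar> / (j \<sigma>\<^sup>2)\<close>, from the change of the
argument, plus \<open>\<kappa> / (j \<sigma>)\<close>, from the change of the smoothing; each multiplies the window of the
\<open>r\<close> latest squares of the block, whence \<open>\<alpha> r\<close> and \<open>\<beta> r\<close>.\<close>

lemma block_bound:
  assumes f: "1-lipschitz_on UNIV f" and p: "1 \<le> p" "t + p \<le> n"
  shows "sum (V f n) {t<..t + p} \<le> \<kappa> / \<sigma> / sqrt (real (t + p)) * \<beta> p
    + (\<Sum>r=1..<p. (\<alpha> r / \<sigma>\<^sup>2 + \<kappa> * \<beta> r / \<sigma>) / real (t + r))"
proof -
  let ?g = "\<lambda>j l x. smoothed f \<sigma> 2 j (S l x)"
  \<comment> \<open>\<open>B p\<close> is the frozen part of a block of length \<open>p\<close>.\<close>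
  define B where "B p = (\<integral>x. ?g (t + p) (n - (t + p)) x * D (n - (t + p)) p x \<partial>M)" for p
  have bound: "\<bar>?g j l x\<bar> \<le> \<kappa> / (\<sigma> * sqrt (real j))" if "1 \<le> j" for j l x
    by (rule smoothed_2_bound[OF f \<sigma>_pos that])
  have "sum (V f n) {t<..t + p} \<le> B p + (\<Sum>r=1..<p. (\<alpha> r / \<sigma>\<^sup>2 + \<kappa> * \<beta> r / \<sigma>) / real (t + r))"
    using p
  proof (induction p rule: nat_induct_at_least)
    case base
    have "{t<..t + 1} = {Suc t}" by auto
    then show ?case
      by (simp add: B_def V_def D_def)
  next
    case (Suc p)
    define l where "l = n - (t + Suc p)"
    define u where "u = t + p"
    have l: "n - u = Suc l" "n - Suc u = l" "1 \<le> u" "t + Suc p = Suc u"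
      using Suc.prems Suc.hyps by (simp_all add: l_def u_def)
    have D_Suc: "D l (Suc p) x = D (Suc l) p x + ((X (Suc l) x)\<^sup>2 - \<sigma>\<^sup>2)" for x
      unfolding D_def by (subst sum.atLeast_Suc_atMost) (simp_all add: sum.shift_bounds_cl_Suc_ivl del: sum.cl_ivl_Suc)
    have Z_int: "integrable M (\<lambda>x. (X (Suc l) x)\<^sup>2 - \<sigma>\<^sup>2)"
      using X_square by simp
    have int: "integrable M (\<lambda>x. ?g j k x * h x)" if "1 \<le> j" "integrable M h" for j k h
      using f that by (rule smoothed_2_mult_int)
    have B_Suc: "B (Suc p) = (\<integral>x. ?g (Suc u) l x * D (Suc l) p x \<partial>M) + V f n (Suc u)"
      unfolding B_def V_def l D_Suc distrib_left
      using int[OF _ D_int] int[OF _ Z_int] by (subst Bochner_Integration.integral_add) simp_all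
    have "B p - (\<integral>x. ?g (Suc u) l x * D (Suc l) p x \<partial>M)
        = (\<integral>x. (?g u (Suc l) x - ?g (Suc u) l x) * D (Suc l) p x \<partial>M)"
      unfolding B_def u_def[symmetric] l left_diff_distrib
      using int[OF _ D_int] l(3) by (subst Bochner_Integration.integral_diff) simp_all
    also have "\<dots> \<le> 1 / (real u * \<sigma>\<^sup>2) * \<alpha> p + \<kappa> / (real u * \<sigma>) * \<beta> p"
    proof (rule future_squares)
      show "(\<lambda>x. ?g u (Suc l) x - ?g (Suc u) l x) \<in> borel_measurable (A (Suc l))"
      proof (intro borel_measurable_diff smoothed_S_adapted f l(3))
        have "(\<lambda>x. ?g (Suc u) l x) \<in> borel_measurable (A l)"
          by (rule smoothed_S_adapted[OF f]) simp
        moreover have "subalgebra (A (Suc l)) (A l)"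
          using A_mono by (simp add: subalgebra_def A_space)
        ultimately show "(\<lambda>x. ?g (Suc u) l x) \<in> borel_measurable (A (Suc l))"
          by (rule measurable_from_subalg[rotated])
      qed
      show "\<bar>?g u (Suc l) x - ?g (Suc u) l x\<bar>
          \<le> \<kappa> / (\<sigma> * sqrt (real u)) + \<kappa> / (\<sigma> * sqrt (real (Suc u)))" for x
        using bound[of u "Suc l" x] bound[of "Suc u" l x] l(3) by linarith
      show "\<bar>?g u (Suc l) x - ?g (Suc u) l x\<bar> \<le> 1 / (real u * \<sigma>\<^sup>2) * \<bar>X (Suc l) x\<bar> + \<kappa> / (real u * \<sigma>)" for x
        using smoothed_2_lipschitz[OF f \<sigma>_pos l(3), of "S (Suc l) x" "S l x"]
          smoothed_2_Suc[OF f \<sigma>_pos l(3), of "S l x"]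
        by (simp add: S_Suc)
    qed (use \<sigma>_pos in auto)
    also have "\<dots> = (\<alpha> p / \<sigma>\<^sup>2 + \<kappa> * \<beta> p / \<sigma>) / real (t + p)"
      by (simp add: u_def add_divide_distrib mult_ac)
    finally have step: "B p + V f n (Suc u) \<le> B (Suc p) + (\<alpha> p / \<sigma>\<^sup>2 + \<kappa> * \<beta> p / \<sigma>) / real (t + p)"
      using B_Suc by linarith
    have "{t<..t + Suc p} = insert (Suc u) {t<..t + p}"
      by (auto simp: u_def)
    then have "sum (V f n) {t<..t + Suc p} = V f n (Suc u) + sum (V f n) {t<..t + p}"
      by (simp add: u_def)
    moreover have "sum (V f n) {t<..t + p} \<le> B p + (\<Sum>r=1..<p. (\<alpha> r / \<sigma>\<^sup>2 + \<kappa> * \<beta> r / \<sigma>) / real (t + r))"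
      using Suc.prems by (intro Suc.IH) simp
    moreover have "(\<Sum>r=1..<Suc p. (\<alpha> r / \<sigma>\<^sup>2 + \<kappa> * \<beta> r / \<sigma>) / real (t + r))
        = (\<Sum>r=1..<p. (\<alpha> r / \<sigma>\<^sup>2 + \<kappa> * \<beta> r / \<sigma>) / real (t + r)) + (\<alpha> p / \<sigma>\<^sup>2 + \<kappa> * \<beta> p / \<sigma>) / real (t + p)"
      using Suc.hyps by (rule sum.atLeastLessThan_Suc)
    ultimately show ?case
      using step by linarith
  qed
  also have "B p \<le> 0 * \<alpha> p + \<kappa> / (\<sigma> * sqrt (real (t + p))) * \<beta> p"
    unfolding B_def
  proof (rule future_squares[OF smoothed_S_adapted[OF f] bound])
    show "\<bar>?g (t + p) (n - (t + p)) x\<bar>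
        \<le> 0 * \<bar>X (n - (t + p)) x\<bar> + \<kappa> / (\<sigma> * sqrt (real (t + p)))" for x
      using bound[of "t + p" "n - (t + p)" x] p by simp
  qed (use p \<sigma>_pos in auto)
  finally show ?thesis by simp
qed

lemma sum_V_bound:
  assumes f: "1-lipschitz_on UNIV f"
  shows "sum (V f n) {0<..n} / 2 \<le> (\<Sum>m=1..nat \<lfloor>sqrt (2 * real n)\<rfloor>. (\<alpha> m + 2 * \<sigma> * \<beta> m) / (real m * \<sigma>\<^sup>2))"
proof -
  have "sum (V f n) {0<..n} \<le> (\<Sum>m=1..nat \<lfloor>sqrt (2 * real n)\<rfloor>.
      (2 * sqrt 2 * (\<kappa> / \<sigma>) * \<beta> m + 2 * (\<alpha> m / \<sigma>\<^sup>2 + \<kappa> * \<beta> m / \<sigma>)) / real m)"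
    using \<sigma>_pos \<alpha>_nonneg \<beta>_nonneg block_bound[OF f]
    by (intro triangular_block_sum) auto
  also have "\<dots> \<le> (\<Sum>m=1..nat \<lfloor>sqrt (2 * real n)\<rfloor>. 2 * ((\<alpha> m + 2 * \<sigma> * \<beta> m) / (real m * \<sigma>\<^sup>2)))"
  proof (rule sum_mono)
    fix m
    have "2 * sqrt 2 * (\<kappa> / \<sigma>) * \<beta> m + 2 * (\<alpha> m / \<sigma>\<^sup>2 + \<kappa> * \<beta> m / \<sigma>)
        = 2 * (\<alpha> m / \<sigma>\<^sup>2 + ((sqrt 2 + 1) * \<kappa>) * \<beta> m / \<sigma>)"
      by (simp only: distrib_left distrib_right add_divide_distrib) simp
    also have "\<dots> \<le> 2 * (\<alpha> m / \<sigma>\<^sup>2 + 2 * \<beta> m / \<sigma>)"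
      using kappa_bounds(1) \<beta>_nonneg \<sigma>_pos
      by (intro mult_left_mono add_left_mono divide_right_mono mult_right_mono) auto
    also have "\<dots> = 2 * ((\<alpha> m + 2 * \<sigma> * \<beta> m) / \<sigma>\<^sup>2)"
      using \<sigma>_pos by (simp add: add_divide_distrib power2_eq_square)
    finally have "(2 * sqrt 2 * (\<kappa> / \<sigma>) * \<beta> m + 2 * (\<alpha> m / \<sigma>\<^sup>2 + \<kappa> * \<beta> m / \<sigma>)) / real m
        \<le> 2 * ((\<alpha> m + 2 * \<sigma> * \<beta> m) / \<sigma>\<^sup>2) / real m"
      by (rule divide_right_mono) simp
    then show "(2 * sqrt 2 * (\<kappa> / \<sigma>) * \<beta> m + 2 * (\<alpha> m / \<sigma>\<^sup>2 + \<kappa> * \<beta> m / \<sigma>)) / real m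
        \<le> 2 * ((\<alpha> m + 2 * \<sigma> * \<beta> m) / (real m * \<sigma>\<^sup>2))"
      by (simp add: mult.commute[of "real m"])
  qed
  finally show ?thesis
    unfolding sum_distrib_left[symmetric] by linarith
qed

lemma smoothed_S_int:
  assumes "1-lipschitz_on UNIV f" "1 \<le> j"
  shows "integrable M (\<lambda>x. smoothed f \<sigma> 0 j (S l x))"
  by (rule lipschitz_comp_integral(1)[OF prob_space_axioms S_int
      smoothed_lipschitz[OF assms(1) \<sigma>_pos assms(2)]])

definition \<Lambda> :: real where
  "\<Lambda> = (\<integral>x. \<bar>X0 x\<bar> ^ 3 \<partial>M) / \<sigma>\<^sup>2"

text \<open>One summand becomes Gaussian. The martingale property removes the first-order term, the third-order
term gives \<open>\<Lambda>\<close>, and the second-order terms of the two expansions combine to \<open>V f n j / 2\<close>.\<close>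

lemma lindeberg_step:
  assumes f: "1-lipschitz_on UNIV f" and j: "1 \<le> j" "j \<le> n"
  shows "(\<integral>x. smoothed f \<sigma> 0 j (S (Suc n - j) x) \<partial>M) - (\<integral>x. smoothed f \<sigma> 0 (Suc j) (S (n - j) x) \<partial>M)
    \<le> \<Lambda> / 6 * (1 / real j) + V f n j / 2 + 49 * \<sigma> / 160 * (1 / (real j * sqrt (real j)))"
proof -
  define l where "l = n - j"
  have l: "Suc n - j = Suc l" using j by (simp add: l_def)
  let ?s = "\<lambda>k j. smoothed f \<sigma> k j"
  let ?c = "49 * \<sigma> / 160 * (1 / (real j * sqrt (real j)))"
  note int0 = smoothed_S_int[OF f j(1), of "Suc l"] smoothed_S_int[OF f, of "Suc j" l, simplified]
  have Z_int: "integrable M (\<lambda>x. (X (Suc l) x)\<^sup>2 - \<sigma>\<^sup>2)"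
    using X_square by simp
  have int1: "integrable M (\<lambda>x. X (Suc l) x * ?s 1 j (S l x))"
    using integrable_mult_bounded[OF X_int[of "Suc l"], of "\<lambda>x. ?s 1 j (S l x)" 1]
      smoothed_1_bound[OF f \<sigma>_pos j(1)]
      measurable_compose[OF S_M smoothed_measurable[OF f \<sigma>_pos j(1)]]
    by (simp add: mult.commute)
  have int2: "integrable M (\<lambda>x. ?s 2 j (S l x) * ((X (Suc l) x)\<^sup>2 - \<sigma>\<^sup>2))"
    by (rule smoothed_2_mult_int[OF f j(1) Z_int])
  have int3: "integrable M (\<lambda>x. \<bar>X (Suc l) x\<bar> ^ 3 / (6 * (real j * \<sigma>\<^sup>2)))"
    using X_cube(1) by simp
  have "(\<integral>x. ?s 0 j (S (Suc l) x) \<partial>M) - (\<integral>x. ?s 0 (Suc j) (S l x) \<partial>M)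
      = (\<integral>x. ?s 0 j (S (Suc l) x) - ?s 0 (Suc j) (S l x) \<partial>M)"
    using int0 by simp
  also have "\<dots> \<le> (\<integral>x. X (Suc l) x * ?s 1 j (S l x)
      + ?s 2 j (S l x) * ((X (Suc l) x)\<^sup>2 - \<sigma>\<^sup>2) / 2
      + \<bar>X (Suc l) x\<bar> ^ 3 / (6 * (real j * \<sigma>\<^sup>2)) + ?c \<partial>M)"
  proof (rule integral_mono)
    fix x
    have "?s 2 j (S l x) * ((X (Suc l) x)\<^sup>2 - \<sigma>\<^sup>2) / 2
        = (X (Suc l) x)\<^sup>2 / 2 * ?s 2 j (S l x) - \<sigma>\<^sup>2 / 2 * ?s 2 j (S l x)"
      by (simp add: algebra_simps diff_divide_distrib)
    then show "?s 0 j (S (Suc l) x) - ?s 0 (Suc j) (S l x) \<le> X (Suc l) x * ?s 1 j (S l x)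
      + ?s 2 j (S l x) * ((X (Suc l) x)\<^sup>2 - \<sigma>\<^sup>2) / 2
      + \<bar>X (Suc l) x\<bar> ^ 3 / (6 * (real j * \<sigma>\<^sup>2)) + ?c"
      using smoothed_taylor[OF f \<sigma>_pos j(1), of "S l x" "X (Suc l) x"]
        smoothed_0_Suc[OF f \<sigma>_pos j(1), of "S l x"]
      unfolding S_Suc by linarith
  qed (use int0 int1 int2 int3 in auto)
  also have "\<dots> = (\<integral>x. X (Suc l) x * ?s 1 j (S l x) \<partial>M) + V f n j / 2
      + (\<integral>x. \<bar>X0 x\<bar> ^ 3 \<partial>M) / (6 * (real j * \<sigma>\<^sup>2)) + ?c"
    using int1 int2 int3 prob_space by (simp add: V_def l_def[symmetric] X_cube(2))
  also have "(\<integral>x. X (Suc l) x * ?s 1 j (S l x) \<partial>M) = 0"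
    by (rule mds_orthogonal[OF smoothed_S_adapted[OF f j(1)] smoothed_1_bound[OF f \<sigma>_pos j(1)]])
  also have "(\<integral>x. \<bar>X0 x\<bar> ^ 3 \<partial>M) / (6 * (real j * \<sigma>\<^sup>2)) = \<Lambda> / 6 * (1 / real j)"
    by (simp add: \<Lambda>_def)
  finally show ?thesis
    unfolding l l_def[symmetric] by simp
qed

text \<open>The telescoped Lindeberg steps. The smoothing removed at the two ends costs \<open>\<kappa> \<sigma>\<close> and
\<open>\<kappa> \<sigma> (sqrt 2 - 1)\<close>, the fourth-order errors at most \<open>147 \<sigma> / 160\<close> in total; together this is
below \<open>13 \<sigma> / 6\<close>.\<close>

lemma S_gauss_bound:
  assumes f: "1-lipschitz_on UNIV f" and n: "1 \<le> n"
  shows "(\<integral>x. f (S n x) \<partial>M) - (\<integral>y. f (\<sigma> * sqrt (real n) * y) \<partial>\<gamma>)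
    \<le> 13 * \<sigma> / 6 + \<Lambda> / 6 * ln (1 + 2 * real n)
      + (\<Sum>m=1..nat \<lfloor>sqrt (2 * real n)\<rfloor>. (\<alpha> m + 2 * \<sigma> * \<beta> m) / (real m * \<sigma>\<^sup>2))"
proof -
  define e where "e j = (\<integral>x. smoothed f \<sigma> 0 j (S (Suc n - j) x) \<partial>M)" for j
  let ?b = "\<lambda>j. \<Lambda> / 6 * (1 / real j) + V f n j / 2 + 49 * \<sigma> / 160 * (1 / (real j * sqrt (real j)))"
  have "e 1 - e (Suc k) \<le> (\<Sum>j=1..k. ?b j)" if "k \<le> n" for k
    using that
  proof (induction k)
    case (Suc k)
    have "e (Suc k) - e (Suc (Suc k)) \<le> ?b (Suc k)"
      using lindeberg_step[OF f, of "Suc k" n] Suc.prems by (simp add: e_def)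
    with Suc.IH Suc.prems have "e 1 - e (Suc (Suc k)) \<le> (\<Sum>j=1..k. ?b j) + ?b (Suc k)"
      by linarith
    then show ?case by simp
  qed simp
  from this[of n] have "e 1 - e (Suc n) \<le> (\<Sum>j=1..n. ?b j)" by simp
  also have "\<dots> = \<Lambda> / 6 * (\<Sum>j=1..n. 1 / real j) + sum (V f n) {0<..n} / 2
      + 49 * \<sigma> / 160 * (\<Sum>j=1..n. 1 / (real j * sqrt (real j)))"
    by (simp only: sum.distrib sum_distrib_left sum_divide_distrib atLeastSucAtMost_greaterThanAtMost One_nat_def)
  also have "\<dots> \<le> \<Lambda> / 6 * ln (1 + 2 * real n)
      + (\<Sum>m=1..nat \<lfloor>sqrt (2 * real n)\<rfloor>. (\<alpha> m + 2 * \<sigma> * \<beta> m) / (real m * \<sigma>\<^sup>2))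
      + 49 * \<sigma> / 160 * 3"
  proof (intro add_mono mult_left_mono harmonic_sum_le_ln sum_V_bound f)
    show "(\<Sum>j=1..n. 1 / (real j * sqrt (real j))) \<le> 3"
      using sum_inverse_three_halves[OF n] by (rule order_trans) simp
    show "0 \<le> \<Lambda> / 6"
      unfolding \<Lambda>_def by (intro divide_nonneg_nonneg integral_nonneg_AE) auto
  qed (use \<sigma>_pos in auto)
  finally have main: "e 1 - e (Suc n) \<le> \<dots>" .
  have "(\<integral>x. f (S n x) \<partial>M) - e 1 \<le> \<kappa> * \<sigma>"
  proof -
    have int: "integrable M (\<lambda>x. f (S n x))"
      by (rule lipschitz_comp_integral(1)[OF prob_space_axioms S_int f])
    have "(\<integral>x. f (S n x) \<partial>M) - e 1 = (\<integral>x. f (S n x) - smoothed f \<sigma> 0 1 (S n x) \<partial>M)"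
      using int smoothed_S_int[OF f, of 1 n] by (simp add: e_def)
    also have "\<dots> \<le> (\<integral>x. \<kappa> * \<sigma> \<partial>M)"
    proof (rule integral_mono)
      show "f (S n x) - smoothed f \<sigma> 0 1 (S n x) \<le> \<kappa> * \<sigma>" for x
        using smoothed_1_close[OF f \<sigma>_pos, of "S n x"] by linarith
    qed (use int smoothed_S_int[OF f, of 1 n] in auto)
    finally show ?thesis by (simp add: prob_space)
  qed
  moreover have "e (Suc n) = smoothed f \<sigma> 0 (Suc n) 0"
    by (simp add: e_def S_def prob_space)
  then have "e (Suc n) - (\<integral>y. f (\<sigma> * sqrt (real n) * y) \<partial>\<gamma>) \<le> \<kappa> * \<sigma> * (sqrt 2 - 1)"
    using smoothed_end[OF f \<sigma>_pos n] by linarith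
  moreover have "\<kappa> * \<sigma> + \<kappa> * \<sigma> * (sqrt 2 - 1) + 49 * \<sigma> / 160 * 3 \<le> 13 * \<sigma> / 6"
    using mult_right_mono[OF kappa_bounds(2), of \<sigma>] \<sigma>_pos by (simp add: algebra_simps)
  ultimately show ?thesis
    using main by linarith
qed

end

section \<open>Rates for the mean central limit theorem\<close>

theorem theorem2p1:
  fixes M :: "'a measure" and T :: "'a \<Rightarrow> 'a" and F :: "'a measure"
    and X0 :: "'a \<Rightarrow> real" and \<sigma> :: real
    and N :: "'b measure" and Y :: "'b \<Rightarrow> real"
  assumes "prob_space M"
    and "bimeasurable_mpt M T"
    and "subalgebra M F"
    and "sets F \<subseteq> sets (shifted_algebra M T F 1)"
    and "X0 \<in> borel_measurable F"
    and "integrable M (\<lambda>x. \<bar>X0 x\<bar> ^ 3)"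
    and "(\<integral>x. X0 x \<partial>M) = 0"
    and "\<And>i :: int. AE x in M.
           real_cond_exp M (shifted_algebra M T F (i - 1)) (shifted_var M T X0 i) x = 0"
    and "\<sigma> > 0"
    and "(\<integral>x. (X0 x)\<^sup>2 \<partial>M) = \<sigma>\<^sup>2"
    and "AE x in M. real_cond_exp M (invariant_algebra M T) (\<lambda>y. (X0 y)\<^sup>2) x = \<sigma>\<^sup>2"
    and "prob_space N"
    and "distributed N lborel Y std_normal_density"
  shows
    "(\<forall>n :: nat. 1 \<le> n \<longrightarrow>
        ennreal (dist1 M (partial_sum M T X0 n) N (\<lambda>y. \<sigma> * sqrt (real n) * Y y))
        \<le> ennreal (13 * \<sigma> / 6
              + ((\<integral>x. \<bar>X0 x\<bar> ^ 3 \<partial>M) / \<sigma>\<^sup>2) / 6 * ln (1 + 2 * real n))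
          + (\<Sum>m = 1..nat \<lfloor>sqrt (2 * real n)\<rfloor>.
              (L1_norm M (\<lambda>x. X0 x * cond_var_dev M T F X0 \<sigma> m x)
                 + ennreal (2 * \<sigma>) * L1_norm M (cond_var_dev M T F X0 \<sigma> m))
              / ennreal (real m * \<sigma>\<^sup>2)))
     \<and>
     ((SUP m \<in> {0 :: nat <..}.
          L1_norm M (\<lambda>x. X0 x * cond_var_dev M T F X0 \<sigma> m x)
            + L1_norm M (cond_var_dev M T F X0 \<sigma> m)) < \<infinity> \<longrightarrow>
      (\<lambda>n :: nat. dist1 M (partial_sum M T X0 n) N (\<lambda>y. \<sigma> * sqrt (real n) * Y y))
        \<in> O(\<lambda>n. ln (real n)))"
proof -
  have shift: "shifted_algebra M T F (int k) = vimage_algebra (space M) (T ^^ k) F" for k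
    by (simp add: shifted_algebra_def int_iter_def)
  have var: "shifted_var M T X0 (int k) = (\<lambda>x. X0 ((T ^^ k) x))" for k
    by (auto simp: shifted_var_def int_iter_def)
  interpret prob_space M by fact
  interpret S: stationary_mds M T F X0 \<sigma>
  proof
    show "sets F \<subseteq> sets (vimage_algebra (space M) T F)"
      using assms(4) shift[of 1] by simp
    show "AE x in M. real_cond_exp M (vimage_algebra (space M) (T ^^ k) F)
        (\<lambda>x. X0 ((T ^^ Suc k) x)) x = 0" for k
      using assms(8)[of "int (Suc k)"] unfolding var by (simp add: shift)
  qed (fact assms)+
  have S_eq: "partial_sum M T X0 n = S.S n" for n
    by (simp add: fun_eq_iff partial_sum_def S.S_def S.X_def var)
  have U_eq: "cond_var_dev M T F X0 \<sigma> m = S.U m" for m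
    by (simp add: fun_eq_iff cond_var_dev_def S.U_def S.sq_sum_def[abs_def] S.X_def var)
  have L1: "L1_norm M h = ennreal (\<integral>x. \<bar>h x\<bar> \<partial>M)" if "integrable M h" for h
    unfolding L1_norm_def using that by (intro nn_integral_eq_integral) auto
  have L1_U: "L1_norm M (S.U m) = ennreal (S.\<beta> m)"
    "L1_norm M (\<lambda>x. X0 x * S.U m x) = ennreal (S.\<alpha> m)" for m
    using L1[OF S.U_int] L1[OF S.X0_U_int] by (simp_all add: S.\<beta>_def S.\<alpha>_def)
  note nonneg = S.\<alpha>_nonneg S.\<beta>_nonneg
  define d where "d n = dist1 M (S.S n) N (\<lambda>y. \<sigma> * sqrt (real n) * Y y)" for n
  define R where "R n = (\<Sum>m=1..nat \<lfloor>sqrt (2 * real n)\<rfloor>.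
    (S.\<alpha> m + 2 * \<sigma> * S.\<beta> m) / (real m * \<sigma>\<^sup>2))" for n
  have Y_int: "integrable N Y"
    using distributed_integrable_var[OF assms(13)] integrable_std_normal_moment[of 1] by simp
  have d_le: "d n \<le> 13 * \<sigma> / 6 + S.\<Lambda> / 6 * ln (1 + 2 * real n) + R n" if "1 \<le> n" for n
    unfolding d_def dist1_def R_def
  proof (rule cSUP_least)
    have "1-lipschitz_on UNIV (\<lambda>x :: real. x)"
      by (intro lipschitz_intros)
    then show "{f :: real \<Rightarrow> real. 1-lipschitz_on UNIV f} \<noteq> {}"
      by blast
    fix f :: "real \<Rightarrow> real" assume "f \<in> {f. 1-lipschitz_on UNIV f}"
    then have f: "1-lipschitz_on UNIV f" by simp
    then have [measurable]: "f \<in> borel_measurable borel"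
      by (rule lipschitz_continuous_measurable)
    have "(\<integral>x. f (\<sigma> * sqrt (real n) * Y x) \<partial>N) = (\<integral>y. f (\<sigma> * sqrt (real n) * y) \<partial>\<gamma>)"
      using distributed_integral[OF assms(13), of "\<lambda>y. f (\<sigma> * sqrt (real n) * y)"]
      by (simp add: integral_gauss)
    then show "(\<integral>x. f (S.S n x) \<partial>M) - (\<integral>x. f (\<sigma> * sqrt (real n) * Y x) \<partial>N)
      \<le> 13 * \<sigma> / 6 + S.\<Lambda> / 6 * ln (1 + 2 * real n)
        + (\<Sum>m=1..nat \<lfloor>sqrt (2 * real n)\<rfloor>. (S.\<alpha> m + 2 * \<sigma> * S.\<beta> m) / (real m * \<sigma>\<^sup>2))"
      using S.S_gauss_bound[OF f that] by simp
  qed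
  have d_nonneg: "0 \<le> d n" for n
  proof -
    have "0 = (\<integral>x. (\<lambda>_. 0 :: real) (S.S n x) \<partial>M) - (\<integral>x. (\<lambda>_. 0) (\<sigma> * sqrt (real n) * Y x) \<partial>N)"
      by simp
    also have "\<dots> \<le> d n"
      unfolding d_def dist1_def
    proof (rule cSUP_upper[of "\<lambda>_. 0"])
      show "bdd_above ((\<lambda>f. (\<integral>x. f (S.S n x) \<partial>M) - (\<integral>x. f (\<sigma> * sqrt (real n) * Y x) \<partial>N)) `
          {f :: real \<Rightarrow> real. 1-lipschitz_on UNIV f})"
        using Y_int by (intro bdd_above_dist1 assms(1,12) S.S_int) simp
    qed (simp add: lipschitz_on_def)
    finally show ?thesis .
  qed
  have \<Lambda>_nonneg: "0 \<le> S.\<Lambda>"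
    unfolding S.\<Lambda>_def by (intro divide_nonneg_nonneg integral_nonneg_AE) auto
  have part_a: "ennreal (d n) \<le> ennreal (13 * \<sigma> / 6 + S.\<Lambda> / 6 * ln (1 + 2 * real n))
      + (\<Sum>m = 1..nat \<lfloor>sqrt (2 * real n)\<rfloor>.
          (ennreal (S.\<alpha> m) + ennreal (2 * \<sigma>) * ennreal (S.\<beta> m)) / ennreal (real m * \<sigma>\<^sup>2))"
    if "1 \<le> n" for n
  proof -
    have "(ennreal (S.\<alpha> m) + ennreal (2 * \<sigma>) * ennreal (S.\<beta> m)) / ennreal (real m * \<sigma>\<^sup>2)
        = ennreal ((S.\<alpha> m + 2 * \<sigma> * S.\<beta> m) / (real m * \<sigma>\<^sup>2))" if "1 \<le> m" for m
      using that nonneg assms(9) by (simp flip: ennreal_mult ennreal_plus add: divide_ennreal)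
    then have "(\<Sum>m = 1..nat \<lfloor>sqrt (2 * real n)\<rfloor>.
          (ennreal (S.\<alpha> m) + ennreal (2 * \<sigma>) * ennreal (S.\<beta> m)) / ennreal (real m * \<sigma>\<^sup>2)) = ennreal (R n)"
      unfolding R_def using nonneg assms(9) by (subst sum_ennreal[symmetric]) (auto intro!: sum.cong)
    moreover have "0 \<le> R n"
      unfolding R_def using nonneg assms(9) by (intro sum_nonneg) auto
    ultimately show ?thesis
      using d_le[OF that] \<Lambda>_nonneg assms(9) by (simp flip: ennreal_plus add: ennreal_leI)
  qed
  have part_b: "d \<in> O(\<lambda>n. ln (real n))"
    if sup: "(SUP m \<in> {0 :: nat <..}. ennreal (S.\<alpha> m) + ennreal (S.\<beta> m)) < \<infinity>"
  proof -
    obtain C where C: "0 \<le> C" "(SUP m \<in> {0 :: nat <..}. ennreal (S.\<alpha> m) + ennreal (S.\<beta> m)) = ennreal C"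
      using sup by (cases "SUP m \<in> {0 :: nat <..}. ennreal (S.\<alpha> m) + ennreal (S.\<beta> m)") auto
    have C_bound: "S.\<alpha> m + S.\<beta> m \<le> C" if "0 < m" for m
    proof -
      have "ennreal (S.\<alpha> m + S.\<beta> m) \<le> ennreal C"
        unfolding C(2)[symmetric] using that nonneg
        by (intro SUP_upper2[of m]) auto
      then show ?thesis using C(1) by simp
    qed
    \<comment> \<open>With bounded norms the sum over \<open>m\<close> is at most \<open>K\<close> times a harmonic sum
      up to \<open>sqrt (2 n)\<close>; for \<open>n \<ge> 5\<close> every logarithm that occurs is at most \<open>2 ln n\<close>,
      and \<open>ln n \<ge> 1\<close>.\<close>
    define K where "K = (1 + 2 * \<sigma>) * C / \<sigma>\<^sup>2"
    have K: "0 \<le> K"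
      using C(1) assms(9) by (simp add: K_def)
    have "norm (d n) \<le> (13 * \<sigma> / 6 + S.\<Lambda> / 3 + 2 * K) * norm (ln (real n))" if n: "5 \<le> n" for n
    proof -
      let ?k = "nat \<lfloor>sqrt (2 * real n)\<rfloor>"
      have "R n \<le> (\<Sum>m=1..?k. K * (1 / real m))"
        unfolding R_def
      proof (rule sum_mono)
        fix m assume "m \<in> {1..?k}"
        then have m: "0 < m" by simp
        have "S.\<alpha> m + 2 * \<sigma> * S.\<beta> m \<le> (1 + 2 * \<sigma>) * (S.\<alpha> m + S.\<beta> m)"
          using nonneg assms(9) by (simp add: algebra_simps)
        also have "\<dots> \<le> (1 + 2 * \<sigma>) * C"
          using C_bound[OF m] assms(9) by (intro mult_left_mono) auto
        finally have "(S.\<alpha> m + 2 * \<sigma> * S.\<beta> m) / (real m * \<sigma>\<^sup>2) \<le> (1 + 2 * \<sigma>) * C / (real m * \<sigma>\<^sup>2)"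
          by (rule divide_right_mono) simp
        also have "\<dots> = K * (1 / real m)"
          by (simp add: K_def)
        finally show "(S.\<alpha> m + 2 * \<sigma> * S.\<beta> m) / (real m * \<sigma>\<^sup>2) \<le> K * (1 / real m)" .
      qed
      also have "\<dots> \<le> K * ln (1 + 2 * real ?k)"
        unfolding sum_distrib_left[symmetric] by (intro mult_left_mono harmonic_sum_le_ln K)
      also have "\<dots> \<le> K * ln ((real n)\<^sup>2)"
      proof (intro mult_left_mono K)
        have "real ?k \<le> sqrt (2 * real n)"
          by simp
        also have "\<dots> \<le> 2 * real n"
          using n by (intro real_le_lsqrt) (auto simp: power2_eq_square)
        finally have "1 + 2 * real ?k \<le> 5 * real n"
          using n by simp
        also have "\<dots> \<le> (real n)\<^sup>2"
          using n by (simp add: power2_eq_square)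
        finally have "1 + 2 * real ?k \<le> (real n)\<^sup>2" .
        moreover have "0 < 1 + 2 * real i" for i :: nat
          by simp
        ultimately show "ln (1 + 2 * real ?k) \<le> ln ((real n)\<^sup>2)"
          by (intro ln_mono)
      qed
      finally have R: "R n \<le> 2 * K * ln (real n)"
        using n by (simp add: ln_realpow)
      have "1 + 2 * real n \<le> (real n)\<^sup>2"
      proof -
        have "1 + 2 * real n \<le> 5 * real n" using n by simp
        also have "\<dots> \<le> (real n)\<^sup>2" using n by (simp add: power2_eq_square)
        finally show ?thesis .
      qed
      then have "ln (1 + 2 * real n) \<le> ln ((real n)\<^sup>2)"
        by (intro ln_mono) auto
      then have ln2: "S.\<Lambda> / 6 * ln (1 + 2 * real n) \<le> S.\<Lambda> / 6 * (2 * ln (real n))"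
        using n \<Lambda>_nonneg by (intro mult_left_mono) (auto simp: ln_realpow)
      have "exp 1 \<le> real n"
        using e_less_272 n by linarith
      then have ln1: "1 \<le> ln (real n)"
        using n by (subst ln_ge_iff) auto
      then have "13 * \<sigma> / 6 * 1 \<le> 13 * \<sigma> / 6 * ln (real n)"
        using assms(9) by (intro mult_left_mono) auto
      with d_le[of n] n R ln2 have "d n \<le> (13 * \<sigma> / 6 + S.\<Lambda> / 3 + 2 * K) * ln (real n)"
        by (simp add: algebra_simps)
      then show ?thesis
        using d_nonneg[of n] ln1 by simp
    qed
    then show ?thesis
      by (intro bigoI[of _ "13 * \<sigma> / 6 + S.\<Lambda> / 3 + 2 * K"])
        (auto simp: eventually_at_top_linorder intro!: exI[of _ 5])
  qed
  show ?thesis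
    unfolding S_eq U_eq L1_U S.\<Lambda>_def[symmetric] d_def[symmetric] using part_a part_b by blast
qed

end
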